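(* Let $M$ be a time-like surface in $\mathbb L^3_1(c)\,{}_f\times I$. Then $\left(\frac{\partial}{\partial z}\right)^T$ is light-like on $M$ if and only if every point $p\in M$ has a neighborhood which can be parametrized by $$\phi(u,v)=\left(\tilde\phi(u,v),u\right),$$ where $\tilde\phi(u,v)$ is a parametrization of a time-like surface $\hat M$ in $\mathbb L^3_1(c)$ with induced metric $$\hat g=-\frac1{f(u)^2}du^2+\frac{E(u,v)}{f(u)^2}(du\,dv+dv\,du)$$ for a non-vanishing smooth function $E$.
   Context: Let $c\in\{-1,0,1\}$. $\mathbb L^3_1(c)$ denotes the 3-dimensional Lorentzian space form with metric $g_c$ of constant curvature $c$ (de Sitter space $\mathbb S^3_1$ for $c=1$, Minkowski space $\mathbb E^3_1$ for $c=0$, anti-de Sitter space $\mathbb H^3_1$ for $c=-1$). Let $I$ be an open interval with coordinate $z$, $f:I\to(0,\infty)$ smooth, and let $\mathbb L^3_1(c)\,{}_f\times I$ be $\mathbb L^3_1(c)\times I$ with the metric $\widetilde g=\langle\cdot,\cdot\rangle=f(z)^2g_c+dz^2$. Points are written (point of $\mathbb L^3_1(c)$, $z$). For a time-like surface $M$ (induced metric Lorentzian), write $\frac{\partial}{\partial z}\big|_M=T+\eta$ with $T=\left(\frac{\partial}{\partial z}\right)^T$ tangent and $\eta$ normal to $M$. $T$ is light-like if $T\ne0$ and $\langle T,T\rangle=0$ at every point. Standing assumptions: $T$ and $\eta$ vanish nowhere, and no open subset of $M$ lies in a totally geodesic hypersurface of the ambient space. *)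

theory Defs
  imports "HOL-Analysis.Analysis"
begin

text \<open>Only meaningful on open sets: the derivatives are full (not one-sided) derivatives.\<close>

primrec times_differentiable_on ::
  "nat \<Rightarrow> 'a::real_normed_vector set \<Rightarrow> ('a \<Rightarrow> 'b::real_normed_vector) \<Rightarrow> bool" where
  "times_differentiable_on 0 S f \<longleftrightarrow> continuous_on S f"
| "times_differentiable_on (Suc n) S f \<longleftrightarrow>
     (\<forall>x\<in>S. f differentiable (at x)) \<and>
     (\<forall>v. times_differentiable_on n S (\<lambda>x. frechet_derivative f (at x) v))"

definition smooth_on :: "'a::real_normed_vector set \<Rightarrow> ('a \<Rightarrow> 'b::real_normed_vector) \<Rightarrow> bool" where
  "smooth_on S f \<longleftrightarrow> (\<forall>n. times_differentiable_on n S f)"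

text \<open>
  A submanifold is a subset M of a topological space together with a map F from M into a
  Euclidean space E; embedded submanifolds of E are the case where F is the identity.
  A local parametrization is a homeomorphism from an open coordinate domain W onto an
  open subset of M that turns F into a smooth immersion.  Any two of these are
  automatically smoothly compatible, so they form the smooth structure of M.
\<close>

definition local_param ::
  "'m::topological_space set \<Rightarrow> ('m \<Rightarrow> 'e::real_normed_vector) \<Rightarrow>
   'd::real_normed_vector set \<Rightarrow> ('d \<Rightarrow> 'm) \<Rightarrow> bool" where
  "local_param M F W \<kappa> \<longleftrightarrow>
     open W \<and> openin (top_of_set M) (\<kappa> ` W) \<and>
     (\<exists>\<kappa>'. homeomorphism W (\<kappa> ` W) \<kappa> \<kappa>') \<and>
     smooth_on W (F \<circ> \<kappa>) \<and>
     (\<forall>w\<in>W. inj (frechet_derivative (F \<circ> \<kappa>) (at w)))"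

definition immersed_surface ::
  "'e::real_normed_vector set \<Rightarrow> 'm::topological_space set \<Rightarrow> ('m \<Rightarrow> 'e) \<Rightarrow> bool" where
  "immersed_surface N M F \<longleftrightarrow>
     F ` M \<subseteq> N \<and>
     (\<forall>p\<in>M. \<exists>(W :: (real \<times> real) set) \<kappa>. local_param M F W \<kappa> \<and> p \<in> \<kappa> ` W)"

definition tangent_plane ::
  "'m::topological_space set \<Rightarrow> ('m \<Rightarrow> 'e::real_normed_vector) \<Rightarrow> 'm \<Rightarrow> 'e set" where
  "tangent_plane M F p =
     {X. \<exists>(W :: (real \<times> real) set) \<kappa> w.
           local_param M F W \<kappa> \<and> w \<in> W \<and> \<kappa> w = p \<and>
           X \<in> range (frechet_derivative (F \<circ> \<kappa>) (at w))}"

type_synonym 'e metric_field = "'e \<Rightarrow> 'e \<Rightarrow> 'e \<Rightarrow> real"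

definition lorentzian_plane :: "('e::real_vector \<Rightarrow> 'e \<Rightarrow> real) \<Rightarrow> 'e set \<Rightarrow> bool" where
  "lorentzian_plane g V \<longleftrightarrow>
     (\<exists>e\<^sub>0 e\<^sub>1. V = span {e\<^sub>0, e\<^sub>1} \<and> g e\<^sub>0 e\<^sub>0 = -1 \<and> g e\<^sub>0 e\<^sub>1 = 0 \<and> g e\<^sub>1 e\<^sub>1 = 1)"

definition timelike_surface ::
  "'e::real_normed_vector metric_field \<Rightarrow> 'e set \<Rightarrow>
   'm::topological_space set \<Rightarrow> ('m \<Rightarrow> 'e) \<Rightarrow> bool" where
  "timelike_surface g N M F \<longleftrightarrow>
     immersed_surface N M F \<and> (\<forall>p\<in>M. lorentzian_plane (g (F p)) (tangent_plane M F p))"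

definition induced_metric ::
  "'e::real_normed_vector metric_field \<Rightarrow> ('d::real_normed_vector \<Rightarrow> 'e) \<Rightarrow> 'd metric_field" where
  "induced_metric g \<phi> w X Y =
     g (\<phi> w) (frechet_derivative \<phi> (at w) X) (frechet_derivative \<phi> (at w) Y)"

text \<open>Well-defined (unique T) only when g is nondegenerate on V, e.g. if V is Lorentzian.\<close>

definition tangential_part ::
  "('e::real_vector \<Rightarrow> 'e \<Rightarrow> real) \<Rightarrow> 'e set \<Rightarrow> 'e \<Rightarrow> 'e" where
  "tangential_part g V X = (THE T. T \<in> V \<and> (\<forall>Y\<in>V. g (X - T) Y = 0))"

definition lightlike :: "('e::real_vector \<Rightarrow> 'e \<Rightarrow> real) \<Rightarrow> 'e \<Rightarrow> bool" where
  "lightlike g X \<longleftrightarrow> X \<noteq> 0 \<and> g X X = 0"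

text \<open>
  The form has signature (-,+,+,+) for c = 1 and (-,+,+,-) for c = -1.  De Sitter and anti-de
  Sitter space are the quadrics where it equals c.  For c = 0 Minkowski space is the linear
  hyperplane on which the last coordinate vanishes, with signature (-,+,+).
\<close>

definition space_form_metric :: "real \<Rightarrow> real ^ 4 \<Rightarrow> real ^ 4 \<Rightarrow> real" where
  "space_form_metric c X Y =
     - X $ 1 * Y $ 1 + X $ 2 * Y $ 2 + X $ 3 * Y $ 3 + (if c = -1 then -1 else 1) * X $ 4 * Y $ 4"

definition space_form :: "real \<Rightarrow> (real ^ 4) set" where
  "space_form c = (if c = 0 then {x. x $ 4 = 0} else {x. space_form_metric c x x = c})"

definition space_form_tangent :: "real \<Rightarrow> real ^ 4 \<Rightarrow> (real ^ 4) set" where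
  "space_form_tangent c x =
     (if c = 0 then {X. X $ 4 = 0} else {X. space_form_metric c x X = 0})"

definition warped_metric :: "real \<Rightarrow> (real \<Rightarrow> real) \<Rightarrow> ((real ^ 4) \<times> real) metric_field" where
  "warped_metric c f p X Y =
     (f (snd p))\<^sup>2 * space_form_metric c (fst X) (fst Y) + snd X * snd Y"

definition d_dz :: "(real ^ 4) \<times> real" where
  "d_dz = (0, 1)"

definition T_part ::
  "real \<Rightarrow> (real \<Rightarrow> real) \<Rightarrow> 'm::topological_space set \<Rightarrow> ('m \<Rightarrow> (real ^ 4) \<times> real) \<Rightarrow>
   'm \<Rightarrow> (real ^ 4) \<times> real" where
  "T_part c f M F p = tangential_part (warped_metric c f (F p)) (tangent_plane M F p) d_dz"

definition eta_part ::
  "real \<Rightarrow> (real \<Rightarrow> real) \<Rightarrow> 'm::topological_space set \<Rightarrow> ('m \<Rightarrow> (real ^ 4) \<times> real) \<Rightarrow>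
   'm \<Rightarrow> (real ^ 4) \<times> real" where
  "eta_part c f M F p = d_dz - T_part c f M F p"

text \<open>
  Koszul's formula for constant vector fields X, Y, Z on an open set of a vector space:
  the value is g(D_X Y, Z), with D the Levi-Civita connection of g.
\<close>

definition christoffel ::
  "'e::real_normed_vector metric_field \<Rightarrow> 'e \<Rightarrow> 'e \<Rightarrow> 'e \<Rightarrow> 'e \<Rightarrow> real" where
  "christoffel g p X Y Z =
     (frechet_derivative (\<lambda>q. g q Y Z) (at p) X
      + frechet_derivative (\<lambda>q. g q X Z) (at p) Y
      - frechet_derivative (\<lambda>q. g q X Y) (at p) Z) / 2"

text \<open>
  For a parametrized submanifold \<open>\<psi>\<close> and coordinate fields a, b: the value g(D_a (d\<psi> b), Z),
  where D is the Levi-Civita connection of g.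
\<close>

definition covariant_second_derivative ::
  "'e::real_normed_vector metric_field \<Rightarrow> ('d::real_normed_vector \<Rightarrow> 'e) \<Rightarrow>
   'd \<Rightarrow> 'd \<Rightarrow> 'd \<Rightarrow> 'e \<Rightarrow> real" where
  "covariant_second_derivative g \<psi> w a b Z =
     g (\<psi> w) (frechet_derivative (\<lambda>w'. frechet_derivative \<psi> (at w') b) (at w) a) Z
     + christoffel g (\<psi> w)
         (frechet_derivative \<psi> (at w) a) (frechet_derivative \<psi> (at w) b) Z"

text \<open>
  Embedded nondegenerate hypersurfaces of the warped product whose second fundamental form
  vanishes.  The normal vectors Z range over the tangent space of the warped product.  The
  metric \<open>warped_metric\<close> is nondegenerate on all of \<open>UNIV \<times> I\<close>; its Levi-Civita connection and
  that of the warped product have the same product with such Z, since the latter connection is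
  the tangential part of the former.
\<close>

definition totally_geodesic_hypersurface ::
  "real \<Rightarrow> (real \<Rightarrow> real) \<Rightarrow> real set \<Rightarrow> ((real ^ 4) \<times> real) set \<Rightarrow> bool" where
  "totally_geodesic_hypersurface c f I S \<longleftrightarrow>
     S \<subseteq> space_form c \<times> I \<and>
     (\<forall>p\<in>S. \<exists>(W :: (real ^ 3) set) \<psi>. local_param S (\<lambda>x. x) W \<psi> \<and> p \<in> \<psi> ` W) \<and>
     (\<forall>(W :: (real ^ 3) set) \<psi>. local_param S (\<lambda>x. x) W \<psi> \<longrightarrow>
        (\<forall>w\<in>W.
           (\<forall>a. (\<forall>b. induced_metric (warped_metric c f) \<psi> w a b = 0) \<longrightarrow> a = 0) \<and>
           (\<forall>Z \<in> space_form_tangent c (fst (\<psi> w)) \<times> UNIV.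
              (\<forall>a. warped_metric c f (\<psi> w) (frechet_derivative \<psi> (at w) a) Z = 0) \<longrightarrow>
              (\<forall>a b. covariant_second_derivative (warped_metric c f) \<psi> w a b Z = 0))))"

end

theory Submission
  imports Defs
begin

text \<open>
  Let \<open>h\<close> be the height function of the surface, that is, its \<open>I\<close>-coordinate.  For a tangent vector
  \<open>Y\<close> one has \<open>\<langle>T, Y\<rangle> = dh(Y)\<close>, so \<open>T\<close> is the gradient of \<open>h\<close> for the induced Lorentzian metric, and
  \<open>\<langle>T, T\<rangle> = dh(T)\<close>.  Hence \<open>T\<close> is light-like exactly when \<open>dh\<close> vanishes nowhere and the level
  curves of \<open>h\<close> are null curves; \<open>T\<close> is then tangent to them.

  Suppose that this holds.  Near a point there are coordinates \<open>(u, s)\<close> with \<open>u = h\<close>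
  (\<open>level_set_coordinates\<close>).  In them the induced metric satisfies \<open>g\<^sub>s\<^sub>s = 0\<close> and \<open>g\<^sub>u\<^sub>s \<noteq> 0\<close>
  (\<open>lightlike_tangential_part_imp_null_coordinate\<close>), and the second null direction of the tangent
  plane is spanned by \<open>\<partial>\<^sub>u + a \<partial>\<^sub>s\<close> with \<open>a = - g\<^sub>u\<^sub>u / (2 g\<^sub>u\<^sub>s)\<close>.  Its integral curves are the graphs
  of the solutions of \<open>s' = a(u, s)\<close>.  Labelling each of them by its value \<open>v\<close> at a fixed height
  gives a second coordinate, and in the coordinates \<open>(u, v)\<close> both coordinate fields are null: the
  induced metric is \<open>E (du dv + dv du)\<close> with \<open>E \<noteq> 0\<close>.  The surface is \<open>(\<phi>(u, v), u)\<close> there, and the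
  warped metric is \<open>f\<^sup>2 g\<^sub>c + dz\<^sup>2\<close>, so subtracting \<open>du\<^sup>2\<close> and dividing by \<open>f\<^sup>2\<close> yields the metric induced by \<open>\<phi>\<close>.
  Conversely, if the metric is \<open>E (du dv + dv du)\<close> and \<open>h = u\<close>, then the gradient of \<open>h\<close> is
  \<open>(1 / E) \<partial>\<^sub>v\<close>, which is null and not zero.

  Three analytic points carry the weight.  The labelling by initial values has to be smooth: the
  flow of a scalar differential equation exists by Picard iteration, and its derivative in the
  initial value comes from an explicit formula for the difference of two solutions, after which
  smoothness follows by bootstrapping (\<open>smooth_scalar_flow\<close>).  The projection \<open>\<phi>\<close> has to parametrize
  an embedded surface: its metric is nondegenerate, so it is an immersion, and an immersion is an
  embedding near each point (\<open>immersion_locally_homeomorphism\<close>).  Finally, \<open>tangent_plane\<close> collects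
  the vectors of all parametrizations at a point, so causal character can be read off from one
  parametrization only because they all give the same plane (\<open>tangent_plane_eq_range\<close>).
\<close>

section \<open>Calculus of smooth maps on open sets\<close>

lemma times_differentiable_on_cong:
  assumes "open S" "\<And>x. x \<in> S \<Longrightarrow> f x = g x" "times_differentiable_on n S f"
  shows "times_differentiable_on n S g"
  using assms(2,3)
proof (induction n arbitrary: f g)
  case 0
  then show ?case by (simp cong: continuous_on_cong)
next
  case (Suc n)
  have D: "(g has_derivative frechet_derivative f (at x)) (at x)" if "x \<in> S" for x
    using Suc.prems that \<open>open S\<close>
    by (metis frechet_derivative_works has_derivative_transform_within_open times_differentiable_on.simps(2))
  then have "frechet_derivative f (at x) = frechet_derivative g (at x)" if "x \<in> S" for x
    using that frechet_derivative_at by blast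
  then have "times_differentiable_on n S (\<lambda>x. frechet_derivative g (at x) v)" for v
    using Suc.prems(2) by (auto intro: Suc.IH[of "\<lambda>x. frechet_derivative f (at x) v"])
  moreover have "\<forall>x\<in>S. g differentiable (at x)"
    using D differentiableI by blast
  ultimately show ?case
    by simp
qed

lemma times_differentiable_on_SucI:
  assumes "open S" "\<And>x. x \<in> S \<Longrightarrow> (f has_derivative f' x) (at x)"
    and "\<And>v. times_differentiable_on n S (\<lambda>x. f' x v)"
  shows "times_differentiable_on (Suc n) S f"
proof -
  have "times_differentiable_on n S (\<lambda>x. frechet_derivative f (at x) v)" for v
    by (rule times_differentiable_on_cong[OF assms(1) _ assms(3)[of v]])
      (metis assms(2) frechet_derivative_at)
  then show ?thesis
    using assms(2) by (auto simp: differentiable_def)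
qed

lemma times_differentiable_on_SucD:
  assumes "times_differentiable_on (Suc n) S f"
  shows "times_differentiable_on n S f"
  using assms
proof (induction n arbitrary: f)
  case 0
  then show ?case
    by (auto intro!: continuous_at_imp_continuous_on differentiable_imp_continuous_within)
next
  case (Suc n)
  then show ?case by (metis times_differentiable_on.simps(2))
qed

lemma times_differentiable_on_imp_continuous_on:
  "times_differentiable_on n S f \<Longrightarrow> continuous_on S f"
  by (induction n) (auto dest: times_differentiable_on_SucD simp del: times_differentiable_on.simps(2))

lemma times_differentiable_on_subset:
  "times_differentiable_on n S f \<Longrightarrow> R \<subseteq> S \<Longrightarrow> times_differentiable_on n R f"
  by (induction n arbitrary: f) (auto intro: continuous_on_subset)

lemma times_differentiable_on_const: "times_differentiable_on n S (\<lambda>x. c)"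
  by (induction n arbitrary: c) (auto simp: frechet_derivative_const)

lemma times_differentiable_on_bounded_linear:
  assumes "open S" "bounded_linear L" "times_differentiable_on n S f"
  shows "times_differentiable_on n S (\<lambda>x. L (f x))"
  using assms(3)
proof (induction n arbitrary: f)
  case 0
  then show ?case by (auto intro: bounded_linear.continuous_on[OF assms(2)])
next
  case (Suc n)
  show ?case
    by (rule times_differentiable_on_SucI[OF \<open>open S\<close>, where f' = "\<lambda>x v. L (frechet_derivative f (at x) v)"])
      (use Suc in \<open>auto intro: bounded_linear.has_derivative[OF assms(2)] simp: frechet_derivative_works\<close>)
qed

lemma times_differentiable_on_id: "open S \<Longrightarrow> times_differentiable_on n S (\<lambda>x. x)"
  by (cases n) (auto intro: times_differentiable_on_SucI[where f' = "\<lambda>x v. v"] times_differentiable_on_const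
      simp del: times_differentiable_on.simps(2))

lemma times_differentiable_on_add:
  assumes "open S" "times_differentiable_on n S f" "times_differentiable_on n S g"
  shows "times_differentiable_on n S (\<lambda>x. f x + g x)"
  using assms(2,3)
proof (induction n arbitrary: f g)
  case 0
  then show ?case by (auto intro: continuous_intros)
next
  case (Suc n)
  show ?case
    by (rule times_differentiable_on_SucI[OF \<open>open S\<close>,
          where f' = "\<lambda>x v. frechet_derivative f (at x) v + frechet_derivative g (at x) v"])
      (use Suc in \<open>auto intro: has_derivative_add simp: frechet_derivative_works\<close>)
qed

text \<open>
  The Leibniz rule writes the derivative as a sum of two terms of the same kind, one order lower.
  This single induction serves products, scalar multiples and metrics applied to two vector fields.
\<close>

lemma times_differentiable_on_bounded_bilinear:
  assumes "bounded_bilinear B" "open S"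
    and "times_differentiable_on n S f" "times_differentiable_on n S g"
  shows "times_differentiable_on n S (\<lambda>x. B (f x) (g x))"
  using assms(3,4)
proof (induction n arbitrary: f g)
  case 0
  then show ?case by (auto intro: bounded_bilinear.continuous_on[OF assms(1)])
next
  case (Suc n)
  note low = Suc.prems[THEN times_differentiable_on_SucD]
  show ?case
    by (rule times_differentiable_on_SucI[OF \<open>open S\<close>,
          where f' = "\<lambda>x v. B (f x) (frechet_derivative g (at x) v) + B (frechet_derivative f (at x) v) (g x)"])
      (use Suc low in \<open>auto intro!: bounded_bilinear.FDERIV[OF assms(1)] times_differentiable_on_add \<open>open S\<close>
        simp: frechet_derivative_works\<close>)
qed

lemmas times_differentiable_on_scaleR =
  times_differentiable_on_bounded_bilinear[OF bounded_bilinear_scaleR]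
lemmas times_differentiable_on_mult =
  times_differentiable_on_bounded_bilinear[OF bounded_bilinear_mult]

lemma times_differentiable_on_minus:
  "open S \<Longrightarrow> times_differentiable_on n S f \<Longrightarrow> times_differentiable_on n S (\<lambda>x. - f x)"
  by (rule times_differentiable_on_bounded_linear[OF _ bounded_linear_minus[OF bounded_linear_ident]])

lemma times_differentiable_on_diff:
  assumes "open S" "times_differentiable_on n S f" "times_differentiable_on n S g"
  shows "times_differentiable_on n S (\<lambda>x. f x - g x)"
  using times_differentiable_on_add[OF assms(1,2) times_differentiable_on_minus[OF assms(1,3)]] by simp

lemma times_differentiable_on_fst:
  "open S \<Longrightarrow> times_differentiable_on n S f \<Longrightarrow> times_differentiable_on n S (\<lambda>x. fst (f x))"
  by (rule times_differentiable_on_bounded_linear[OF _ bounded_linear_fst])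

lemma times_differentiable_on_snd:
  "open S \<Longrightarrow> times_differentiable_on n S f \<Longrightarrow> times_differentiable_on n S (\<lambda>x. snd (f x))"
  by (rule times_differentiable_on_bounded_linear[OF _ bounded_linear_snd])

lemma times_differentiable_on_Pair:
  assumes "open S" "times_differentiable_on n S f" "times_differentiable_on n S g"
  shows "times_differentiable_on n S (\<lambda>x. (f x, g x))"
proof -
  have "bounded_linear (\<lambda>y. (y, 0))" "bounded_linear (\<lambda>z. (0, z))"
    by (auto intro: bounded_linear_Pair bounded_linear_ident bounded_linear_zero)
  from times_differentiable_on_add[OF assms(1)
      times_differentiable_on_bounded_linear[OF assms(1) this(1) assms(2)]
      times_differentiable_on_bounded_linear[OF assms(1) this(2) assms(3)]]
  show ?thesis by simp
qed

lemma times_differentiable_on_sum: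
  assumes "open S" "finite A" "\<And>i. i \<in> A \<Longrightarrow> times_differentiable_on n S (f i)"
  shows "times_differentiable_on n S (\<lambda>x. \<Sum>i\<in>A. f i x)"
  using assms(2,3)
  by (induction A rule: finite_induct)
    (auto intro: times_differentiable_on_const times_differentiable_on_add[OF assms(1)])

text \<open>
  The derivative of the outer map is evaluated at a moving point on a moving vector.  Expanding
  that vector in a basis turns the chain rule into a finite sum of products of scalar functions
  with compositions of lower order, to which the induction hypothesis applies; this is where the
  finite dimension of the intermediate space enters.
\<close>

lemma times_differentiable_on_compose:
  fixes f :: "'b::euclidean_space \<Rightarrow> 'c::real_normed_vector"
  assumes "open S" "open R" "times_differentiable_on n S g" "g ` S \<subseteq> R"
    and "times_differentiable_on n R f"
  shows "times_differentiable_on n S (\<lambda>x. f (g x))"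
  using assms(3,5)
proof (induction n arbitrary: f)
  case 0
  then show ?case
    using assms(4) by (auto intro: continuous_on_compose2)
next
  case (Suc n)
  let ?f' = "\<lambda>x. frechet_derivative f (at x)" and ?g' = "\<lambda>x. frechet_derivative g (at x)"
  have D: "((\<lambda>x. f (g x)) has_derivative (\<lambda>v. \<Sum>b\<in>Basis. (?g' x v \<bullet> b) *\<^sub>R ?f' (g x) b)) (at x)"
    if "x \<in> S" for x
  proof -
    have f: "(f has_derivative ?f' (g x)) (at (g x))" and g: "(g has_derivative ?g' x) (at x)"
      using Suc.prems that assms(4) by (auto simp: frechet_derivative_works)
    have "?f' (g x) w = (\<Sum>b\<in>Basis. (w \<bullet> b) *\<^sub>R ?f' (g x) b)" for w
    proof -
      have "linear (?f' (g x))"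
        by (rule bounded_linear.linear[OF has_derivative_bounded_linear[OF f]])
      then have "?f' (g x) (\<Sum>b\<in>Basis. (w \<bullet> b) *\<^sub>R b) = (\<Sum>b\<in>Basis. (w \<bullet> b) *\<^sub>R ?f' (g x) b)"
        by (simp add: linear_sum linear_cmul)
      then show ?thesis by (simp add: euclidean_representation)
    qed
    then have "(\<lambda>v. ?f' (g x) (?g' x v)) = (\<lambda>v. \<Sum>b\<in>Basis. (?g' x v \<bullet> b) *\<^sub>R ?f' (g x) b)"
      by (rule ext)
    then show ?thesis
      using has_derivative_compose[OF g f] by (simp only:)
  qed
  show ?case
  proof (rule times_differentiable_on_SucI[OF \<open>open S\<close> D])
    fix v
    have "times_differentiable_on n S (\<lambda>x. ?g' x v \<bullet> b)" for b
      by (rule times_differentiable_on_bounded_linear[OF \<open>open S\<close> bounded_linear_inner_left]) (use Suc.prems(1) in simp)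
    moreover have "times_differentiable_on n S (\<lambda>x. ?f' (g x) b)" for b
      by (rule Suc.IH[OF times_differentiable_on_SucD[OF Suc.prems(1)]]) (use Suc.prems(2) in simp)
    ultimately show "times_differentiable_on n S (\<lambda>x. \<Sum>b\<in>Basis. (?g' x v \<bullet> b) *\<^sub>R ?f' (g x) b)"
      by (intro times_differentiable_on_sum times_differentiable_on_scaleR \<open>open S\<close> finite_Basis)
  qed
qed

lemma times_differentiable_on_inverse:
  fixes f :: "'a::real_normed_vector \<Rightarrow> real"
  assumes "open S" "times_differentiable_on n S f" "\<And>x. x \<in> S \<Longrightarrow> f x \<noteq> 0"
  shows "times_differentiable_on n S (\<lambda>x. inverse (f x))"
  using assms(2)
proof (induction n)
  case 0
  then show ?case using assms(3) by (auto intro: continuous_intros)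
next
  case (Suc n)
  show ?case
    by (rule times_differentiable_on_SucI[OF \<open>open S\<close>,
          where f' = "\<lambda>x v. - (inverse (f x) * frechet_derivative f (at x) v * inverse (f x))"])
      (use Suc.prems Suc.IH[OF times_differentiable_on_SucD[OF Suc.prems]] assms(3)
        in \<open>auto intro!: has_derivative_inverse times_differentiable_on_minus times_differentiable_on_mult
          \<open>open S\<close> simp: frechet_derivative_works\<close>)
qed

lemma times_differentiable_on_divide:
  fixes f g :: "'a::real_normed_vector \<Rightarrow> real"
  assumes "open S" "times_differentiable_on n S f" "times_differentiable_on n S g" "\<And>x. x \<in> S \<Longrightarrow> g x \<noteq> 0"
  shows "times_differentiable_on n S (\<lambda>x. f x / g x)"
  unfolding divide_inverse
  by (intro times_differentiable_on_mult times_differentiable_on_inverse assms)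

lemma times_differentiable_on_exp:
  fixes f :: "'a::real_normed_vector \<Rightarrow> real"
  assumes "open S" "times_differentiable_on n S f"
  shows "times_differentiable_on n S (\<lambda>x. exp (f x))"
  using assms(2)
proof (induction n)
  case 0
  then show ?case by (auto intro: continuous_intros)
next
  case (Suc n)
  show ?case
    by (rule times_differentiable_on_SucI[OF \<open>open S\<close>,
          where f' = "\<lambda>x v. frechet_derivative f (at x) v * exp (f x)"])
      (use Suc.prems Suc.IH[OF times_differentiable_on_SucD[OF Suc.prems]]
        in \<open>auto intro!: derivative_eq_intros times_differentiable_on_mult
          \<open>open S\<close> simp: frechet_derivative_works\<close>)
qed


lemmas times_differentiable_on_intros =
  times_differentiable_on_const times_differentiable_on_id times_differentiable_on_add
  times_differentiable_on_minus times_differentiable_on_diff times_differentiable_on_mult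
  times_differentiable_on_scaleR times_differentiable_on_divide times_differentiable_on_exp
  times_differentiable_on_Pair times_differentiable_on_fst times_differentiable_on_snd

lemma smooth_on_has_derivative:
  "smooth_on S f \<Longrightarrow> x \<in> S \<Longrightarrow> (f has_derivative frechet_derivative f (at x)) (at x)"
  unfolding smooth_on_def by (metis frechet_derivative_works times_differentiable_on.simps(2))

lemma smooth_on_continuous_on: "smooth_on S f \<Longrightarrow> continuous_on S f"
  unfolding smooth_on_def by (metis times_differentiable_on.simps(1))

lemma smooth_on_frechet_derivative:
  "smooth_on S f \<Longrightarrow> smooth_on S (\<lambda>x. frechet_derivative f (at x) v)"
  unfolding smooth_on_def by (metis times_differentiable_on.simps(2))

lemma smooth_on_subset: "smooth_on S f \<Longrightarrow> R \<subseteq> S \<Longrightarrow> smooth_on R f"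
  unfolding smooth_on_def by (metis times_differentiable_on_subset)

lemma smooth_on_compose:
  fixes f :: "'b::euclidean_space \<Rightarrow> 'c::real_normed_vector"
  assumes "open S" "open R" "smooth_on S g" "g ` S \<subseteq> R" "smooth_on R f"
  shows "smooth_on S (\<lambda>x. f (g x))"
  using assms times_differentiable_on_compose unfolding smooth_on_def by blast

lemma smooth_on_continuous_blinfun:
  fixes f :: "'a::euclidean_space \<Rightarrow> 'b::real_normed_vector"
  assumes "smooth_on S f"
  shows "\<exists>f'. continuous_on S f' \<and> (\<forall>x\<in>S. blinfun_apply (f' x) = frechet_derivative f (at x))"
proof (intro exI conjI ballI)
  let ?f' = "\<lambda>x. Blinfun (frechet_derivative f (at x))"
  show eq: "blinfun_apply (?f' x) = frechet_derivative f (at x)" if "x \<in> S" for x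
    using smooth_on_has_derivative[OF assms that] has_derivative_bounded_linear bounded_linear_Blinfun_apply by blast
  show "continuous_on S ?f'"
  proof (rule continuous_on_blinfun_componentwise)
    fix b :: 'a
    show "continuous_on S (\<lambda>x. ?f' x b)"
      using smooth_on_continuous_on[OF smooth_on_frechet_derivative[OF assms, of b]] eq
      by (simp cong: continuous_on_cong)
  qed
qed

section \<open>Integration along the first coordinate\<close>

lemma has_derivative_from_partials:
  fixes g :: "real \<times> real \<Rightarrow> real"
  assumes "open U" "open V" "convex V" "(u, v) \<in> U \<times> V"
    and "((\<lambda>u. g (u, v)) has_real_derivative p) (at u)"
    and "\<And>u v. u \<in> U \<Longrightarrow> v \<in> V \<Longrightarrow> ((\<lambda>v. g (u, v)) has_real_derivative q (u, v)) (at v)"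
    and "continuous_on (U \<times> V) q"
  shows "(g has_derivative (\<lambda>w. p * fst w + q (u, v) * snd w)) (at (u, v))"
proof -
  have "((\<lambda>(u, v). g (u, v)) has_derivative
      (\<lambda>(x, y). (*) p x + blinfun_apply (blinfun_mult_right (q (u, v))) y)) (at (u, v) within U \<times> V)"
  proof (rule has_derivative_partialsI)
    show "((\<lambda>u. g (u, v)) has_derivative (*) p) (at u within U)"
      using assms(5) by (simp add: has_field_derivative_def has_derivative_at_withinI)
    show "((\<lambda>v. g (u, v)) has_derivative blinfun_apply (blinfun_mult_right (q (u, v)))) (at v within V)"
      if "u \<in> U" "v \<in> V" for u v
      using assms(6)[OF that]
      by (simp add: has_field_derivative_def has_derivative_at_withinI bounded_linear_mult_right
          blinfun_mult_right.rep_eq)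
    have "continuous_on (U \<times> V) (\<lambda>w. blinfun_mult_right (q w))"
      by (intro bounded_linear.continuous_on[OF bounded_linear_blinfun_mult_right] assms)
    then show "continuous (at (u, v) within U \<times> V) (\<lambda>(u, v). blinfun_mult_right (q (u, v)))"
      using assms(4) by (auto simp: continuous_on_eq_continuous_within case_prod_beta')
  qed (use assms in auto)
  moreover have "at (u, v) within U \<times> V = at (u, v)"
    using assms by (intro at_within_open open_Times)
  ultimately show ?thesis
    by (simp add: case_prod_beta' blinfun_mult_right.rep_eq)
qed

lemma has_derivative_imp_second_partial:
  fixes k :: "real \<times> real \<Rightarrow> real"
  assumes "(k has_derivative k') (at (t, s))"
  shows "((\<lambda>s. k (t, s)) has_real_derivative k' (0, 1)) (at s)"
proof -
  have D: "((\<lambda>s. k (t, s)) has_derivative (\<lambda>y. k' (0, y))) (at s)"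
    using assms by (rule has_derivative_compose[rotated]) (auto intro!: derivative_eq_intros)
  have "linear k'"
    by (rule bounded_linear.linear[OF has_derivative_bounded_linear[OF assms]])
  then have "k' (y *\<^sub>R (0, 1)) = y *\<^sub>R k' (0, 1)" for y
    by (rule linear_cmul)
  then have "k' (0, y) = y * k' (0, 1)" for y
    unfolding scaleR_Pair scaleR_zero_right real_scaleR_def mult_1_right mult_zero_right .
  then have "k' (0, y) = k' (0, 1) * y" for y
    by (metis mult.commute)
  then have "(\<lambda>y. k' (0, y)) = (*) (k' (0, 1))"
    by (rule ext)
  then show ?thesis
    using D unfolding has_field_derivative_def by (simp only:)
qed

text \<open>
  This is the integral of \<open>k(\<cdot>, v)\<close> from \<open>u0\<close> to \<open>u\<close> at the point \<open>(u, v)\<close>, rescaled to the unit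
  interval.  The fixed domain of integration makes joint continuity and differentiation under the
  integral sign directly applicable, and covers \<open>u < u0\<close> without a sign convention.
\<close>

definition integral_along_first :: "real \<Rightarrow> (real \<times> 'p \<Rightarrow> real) \<Rightarrow> real \<times> 'p \<Rightarrow> real" where
  "integral_along_first u0 k x =
     (fst x - u0) * integral {0..1} (\<lambda>\<theta>. k (u0 + \<theta> * (fst x - u0), snd x))"

lemma segment_in_convex:
  fixes U :: "real set"
  assumes "convex U" "u0 \<in> U" "u \<in> U" "\<theta> \<in> {0..1}"
  shows "u0 + \<theta> * (u - u0) \<in> U"
  using convexD_alt[OF assms(1-3), of \<theta>] assms(4) by (simp add: algebra_simps)

lemma continuous_on_integral_along_first:
  fixes k :: "real \<times> 'p::topological_space \<Rightarrow> real"
  assumes "convex U" "u0 \<in> U" "continuous_on (U \<times> V) k"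
  shows "continuous_on (U \<times> V) (integral_along_first u0 k)"
proof -
  have "continuous_on ((U \<times> V) \<times> cbox 0 1) (\<lambda>(x, \<theta>). k (u0 + \<theta> * (fst x - u0), snd x))"
    unfolding case_prod_beta'
    by (rule continuous_on_compose2[OF assms(3)])
      (auto intro!: continuous_intros segment_in_convex assms(1,2))
  from integral_continuous_on_param[OF this] show ?thesis
    unfolding integral_along_first_def by (intro continuous_intros) simp
qed

lemma continuous_on_first_segment:
  fixes k :: "real \<times> 'p::topological_space \<Rightarrow> real"
  assumes "convex U" "u0 \<in> U" "u \<in> U" "v \<in> V" "continuous_on (U \<times> V) k"
  shows "continuous_on {0..1} (\<lambda>\<theta>. k (u0 + \<theta> * (u - u0), v))"
  by (rule continuous_on_compose2[OF assms(5)])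
    (auto intro!: continuous_intros segment_in_convex assms)

lemma integral_along_first_diff_bound:
  fixes k l :: "real \<times> 'p::topological_space \<Rightarrow> real"
  assumes "convex U" "u0 \<in> U" "u \<in> U" "v \<in> V" "continuous_on (U \<times> V) k" "continuous_on (U \<times> V) l"
    and "\<And>t. t \<in> U \<Longrightarrow> \<bar>k (t, v) - l (t, v)\<bar> \<le> m"
  shows "\<bar>integral_along_first u0 k (u, v) - integral_along_first u0 l (u, v)\<bar> \<le> \<bar>u - u0\<bar> * m"
proof -
  let ?k = "\<lambda>\<theta>. k (u0 + \<theta> * (u - u0), v)" and ?l = "\<lambda>\<theta>. l (u0 + \<theta> * (u - u0), v)"
  have c: "continuous_on {0..1} ?k" "continuous_on {0..1} ?l"
    by (rule continuous_on_first_segment[OF assms(1-4)], fact)+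
  have "norm (integral {0..1} (\<lambda>\<theta>. ?k \<theta> - ?l \<theta>)) \<le> m * (1 - 0)"
    using c by (intro integral_bound continuous_intros) (auto intro!: assms(7) segment_in_convex assms(1-3))
  moreover have "integral {0..1} (\<lambda>\<theta>. ?k \<theta> - ?l \<theta>) = integral {0..1} ?k - integral {0..1} ?l"
    using c by (intro integral_diff integrable_continuous_real)
  ultimately have "\<bar>u - u0\<bar> * \<bar>integral {0..1} ?k - integral {0..1} ?l\<bar> \<le> \<bar>u - u0\<bar> * m"
    by (intro mult_left_mono) auto
  then show ?thesis
    by (simp add: integral_along_first_def abs_mult flip: right_diff_distrib)
qed

lemma integral_along_first_cong:
  assumes "convex U" "u0 \<in> U" "u \<in> U" "\<And>t. t \<in> U \<Longrightarrow> k (t, v) = l (t, v)"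
  shows "integral_along_first u0 k (u, v) = integral_along_first u0 l (u, v)"
  unfolding integral_along_first_def
  by (auto intro!: integral_cong assms(4) segment_in_convex assms)

text \<open>
  Hadamard's form of the mean value theorem: the difference quotient is an average of the
  derivative, hence depends continuously on both points even where they coincide.
\<close>

lemma difference_eq_integral_derivative:
  fixes K :: "real \<Rightarrow> real"
  assumes "convex U" "y \<in> U" "x \<in> U" "\<And>t. t \<in> U \<Longrightarrow> (K has_real_derivative k t) (at t)"
  shows "K x - K y = (x - y) * integral {0..1} (\<lambda>\<theta>. k (y + \<theta> * (x - y)))"
proof -
  have "((\<lambda>\<theta>. (x - y) * k (y + \<theta> * (x - y))) has_integral
      K (y + 1 * (x - y)) - K (y + 0 * (x - y))) {0..1}"
  proof (rule fundamental_theorem_of_calculus)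
    fix \<theta> :: real assume "\<theta> \<in> {0..1}"
    then have "(K has_real_derivative k (y + \<theta> * (x - y))) (at (y + \<theta> * (x - y)))"
      by (intro assms(4) segment_in_convex assms(1-3))
    moreover have "((\<lambda>\<theta>. y + \<theta> * (x - y)) has_real_derivative (x - y)) (at \<theta>)"
      by (auto intro!: derivative_eq_intros)
    ultimately have "((\<lambda>\<theta>. K (y + \<theta> * (x - y))) has_real_derivative
        k (y + \<theta> * (x - y)) * (x - y)) (at \<theta>)"
      by (rule DERIV_chain2)
    then show "((\<lambda>\<theta>. K (y + \<theta> * (x - y))) has_vector_derivative
        (x - y) * k (y + \<theta> * (x - y))) (at \<theta> within {0..1})"
      by (simp add: has_real_derivative_iff_has_vector_derivative mult.commute
          has_vector_derivative_at_within)
  qed simp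
  from integral_unique[OF this] show ?thesis
    by simp
qed

lemma integral_along_first_derivative:
  fixes k :: "real \<times> 'p::topological_space \<Rightarrow> real"
  assumes "u \<in> {u0 - d<..<u0 + d}" "v \<in> V" "continuous_on ({u0 - d<..<u0 + d} \<times> V) k"
  shows "((\<lambda>u. integral_along_first u0 k (u, v)) has_real_derivative k (u, v)) (at u)"
proof -
  let ?U = "{u0 - d<..<u0 + d}"
  have U: "convex ?U" "u0 \<in> ?U"
    using assms(1) by auto
  have "continuous_on ?U (\<lambda>t. k (t, v))"
    by (rule continuous_on_compose2[OF assms(3)]) (use assms(2) in \<open>auto intro!: continuous_intros\<close>)
  then have "isCont (\<lambda>t. k (t, v)) t" if "t \<in> ?U" for t
    using that by (simp add: continuous_on_eq_continuous_at)
  then obtain K where K: "(K has_vector_derivative k (t, v)) (at t)" if "t \<in> ?U" for t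
    using einterval_antiderivative[of "ereal (u0 - d)" "ereal (u0 + d)" "\<lambda>t. k (t, v)"] U(2) by auto
  have eq: "integral_along_first u0 k (x, v) = K x - K u0" if x: "x \<in> ?U" for x
    using difference_eq_integral_derivative[OF U x, of K "\<lambda>t. k (t, v)"] K
    by (simp add: integral_along_first_def has_real_derivative_iff_has_vector_derivative)
  have "((\<lambda>x. K x - K u0) has_real_derivative k (u, v)) (at u)"
    using K[OF assms(1)] by (auto intro!: derivative_eq_intros simp: has_real_derivative_iff_has_vector_derivative)
  then show ?thesis
    by (rule has_field_derivative_transform_within_open[where S = ?U]) (use assms(1) eq in auto)
qed

lemma integral_along_first_parameter_derivative:
  fixes k :: "real \<times> real \<Rightarrow> real"
  assumes "convex U" "u0 \<in> U" "u \<in> U" "open V" "convex V" "v \<in> V"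
    and "continuous_on (U \<times> V) k" "continuous_on (U \<times> V) k'"
    and "\<And>t v. t \<in> U \<Longrightarrow> v \<in> V \<Longrightarrow> ((\<lambda>v. k (t, v)) has_real_derivative k' (t, v)) (at v)"
  shows "((\<lambda>v. integral_along_first u0 k (u, v)) has_real_derivative integral_along_first u0 k' (u, v)) (at v)"
proof -
  let ?s = "\<lambda>\<theta>. u0 + \<theta> * (u - u0)"
  have "((\<lambda>v. integral (cbox 0 1) (\<lambda>\<theta>. k (?s \<theta>, v))) has_field_derivative
      integral (cbox 0 1) (\<lambda>\<theta>. k' (?s \<theta>, v))) (at v within V)"
  proof (rule leibniz_rule_field_derivative)
    show "((\<lambda>v. k (?s \<theta>, v)) has_field_derivative k' (?s \<theta>, v)) (at v within V)"
      if "v \<in> V" "\<theta> \<in> cbox 0 1" for v \<theta>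
      by (rule has_field_derivative_at_within, rule assms(9))
        (use that in \<open>auto intro!: segment_in_convex assms(1-3)\<close>)
    show "(\<lambda>\<theta>. k (?s \<theta>, v)) integrable_on cbox 0 1" if "v \<in> V" for v
      using continuous_on_first_segment[OF assms(1-3) that assms(7)]
      by (simp add: integrable_continuous_real)
    show "continuous_on (V \<times> cbox 0 1) (\<lambda>(v, \<theta>). k' (?s \<theta>, v))"
      unfolding case_prod_beta'
      by (rule continuous_on_compose2[OF assms(8)])
        (auto intro!: continuous_intros segment_in_convex assms(1-3))
  qed (use assms in auto)
  from DERIV_cmult[OF this, of "u - u0"] show ?thesis
    unfolding integral_along_first_def at_within_open[OF assms(6,4)] by simp
qed

text \<open>
  By the fundamental theorem of calculus the derivative in the first coordinate is the integrand
  itself, and in the second coordinate it is the same integral of the partial derivative of the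
  integrand; both have one order less.
\<close>

lemma times_differentiable_on_integral_along_first:
  fixes k :: "real \<times> real \<Rightarrow> real"
  assumes "open V" "convex V" "times_differentiable_on n ({u0 - d<..<u0 + d} \<times> V) k"
  shows "times_differentiable_on n ({u0 - d<..<u0 + d} \<times> V) (integral_along_first u0 k)"
  using assms(3)
proof (induction n arbitrary: k)
  case 0
  show ?case
  proof (cases "d > 0")
    case True
    then show ?thesis
      using continuous_on_integral_along_first[of "{u0 - d<..<u0 + d}" u0 V k] 0 by simp
  qed simp
next
  case (Suc n)
  let ?U = "{u0 - d<..<u0 + d}"
  let ?k' = "\<lambda>x. frechet_derivative k (at x) (0, 1)"
  have k': "times_differentiable_on n (?U \<times> V) ?k'" and k: "times_differentiable_on n (?U \<times> V) k"
    using times_differentiable_on_SucD[OF Suc.prems] Suc.prems by simp_all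
  note cont = k'[THEN times_differentiable_on_imp_continuous_on] k[THEN times_differentiable_on_imp_continuous_on]
  have part: "((\<lambda>v. k (t, v)) has_real_derivative ?k' (t, v)) (at v)" if "t \<in> ?U" "v \<in> V" for t v
  proof -
    have "(k has_derivative frechet_derivative k (at (t, v))) (at (t, v))"
      using Suc.prems that by (auto simp: frechet_derivative_works)
    then show ?thesis
      by (rule has_derivative_imp_second_partial)
  qed
  show ?case
  proof (rule times_differentiable_on_SucI)
    show op: "open (?U \<times> V)" using assms(1) by (intro open_Times) auto
    show "(integral_along_first u0 k has_derivative (\<lambda>w. k x * fst w + integral_along_first u0 ?k' x * snd w)) (at x)"
      if mem: "x \<in> ?U \<times> V" for x
    proof -
      obtain u v where x: "x = (u, v)" "u \<in> ?U" "v \<in> V"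
        using mem by blast
      then have U: "convex ?U" "u0 \<in> ?U" by auto
      show ?thesis
        unfolding x(1)
        by (rule has_derivative_from_partials[where U = ?U and V = V])
          (use x U assms(1,2) cont part in \<open>auto intro!: integral_along_first_derivative
             integral_along_first_parameter_derivative[where U = ?U] continuous_on_integral_along_first\<close>)
    qed
    show "times_differentiable_on n (?U \<times> V) (\<lambda>x. k x * fst w + integral_along_first u0 ?k' x * snd w)" for w
      by (intro times_differentiable_on_intros op k Suc.IH k')
  qed
qed

section \<open>Scalar differential equations depending on their initial value\<close>

lemma max_min_mem: "a \<le> b \<Longrightarrow> max a (min b x) \<in> {a..b}" for a b x :: real
  by auto

lemma max_min_eq: "x \<in> {a..b} \<Longrightarrow> max a (min b x) = x" for a b x :: real
  by auto

lemma max_min_contract: "\<bar>max a (min b x) - max a (min b y)\<bar> \<le> \<bar>x - y\<bar>" for a b x y :: real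
  by (auto simp: max_def min_def)

text \<open>
  The integral equation is solved for all initial values \<open>v\<close> at once, as a fixed point of a
  contraction on the bounded continuous functions of the pair \<open>(u, v)\<close>.  Joint continuity of the
  solution in \<open>(u, v)\<close> is then part of the construction.
\<close>

lemma picard_fixed_point:
  fixes A :: "real \<times> real \<Rightarrow> real"
  assumes "continuous_on UNIV A" "d > 0" "d * L \<le> 1 / 2" "L \<ge> 0"
    and bound: "\<And>x. \<bar>A x\<bar> \<le> m"
    and lipschitz: "\<And>t s s'. \<bar>A (t, s) - A (t, s')\<bar> \<le> L * \<bar>s - s'\<bar>"
  obtains \<sigma> where "continuous_on UNIV \<sigma>"
    and "\<And>u v. u \<in> {u0 - d<..<u0 + d} \<Longrightarrow> v \<in> {v0 - d<..<v0 + d} \<Longrightarrow>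
      \<sigma> (u, v) = v + integral_along_first u0 (\<lambda>x. A (fst x, \<sigma> x)) (u, v)"
    and "\<And>u v. u \<in> {u0 - d<..<u0 + d} \<Longrightarrow> v \<in> {v0 - d<..<v0 + d} \<Longrightarrow>
      \<bar>\<sigma> (u, v) - v\<bar> \<le> d * m"
proof -
  \<comment> \<open>Arguments are clamped to a compact square, which makes the image of the operator bounded on the whole plane.\<close>
  define cu where "cu u = max (u0 - d) (min (u0 + d) u)" for u
  define cv where "cv v = max (v0 - d) (min (v0 + d) v)" for v
  define G where "G \<sigma> = integral_along_first u0 (\<lambda>x. A (fst x, \<sigma> x))" for \<sigma> :: "real \<times> real \<Rightarrow> real"
  define \<Phi> where "\<Phi> \<sigma> x = cv (snd x) + G \<sigma> (cu (fst x), cv (snd x))" for \<sigma> x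
  have cu: "\<bar>cu u - u0\<bar> \<le> d" and cv: "\<bar>cv u - v0\<bar> \<le> d" for u
    using max_min_mem[of "u0 - d" "u0 + d" u] max_min_mem[of "v0 - d" "v0 + d" u] \<open>d > 0\<close>
    by (auto simp: cu_def cv_def)
  have contA: "continuous_on UNIV (\<lambda>x. A (fst x, \<sigma> x))" if "continuous_on UNIV \<sigma>" for \<sigma>
    by (rule continuous_on_compose2[OF assms(1)]) (use that in \<open>auto intro!: continuous_intros\<close>)
  have contG: "continuous_on UNIV (G \<sigma>)" if "continuous_on UNIV \<sigma>" for \<sigma>
    using continuous_on_integral_along_first[of UNIV u0 UNIV] contA[OF that] by (simp add: G_def)
  have boundG: "\<bar>G \<sigma> (cu u, v)\<bar> \<le> d * m" if "continuous_on UNIV \<sigma>" for \<sigma> u v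
  proof -
    have "\<bar>G \<sigma> (cu u, v) - integral_along_first u0 (\<lambda>x. 0) (cu u, v)\<bar> \<le> \<bar>cu u - u0\<bar> * m"
      unfolding G_def
      by (rule integral_along_first_diff_bound[where U = UNIV and V = UNIV])
        (use contA[OF that] bound in auto)
    also have "\<dots> \<le> d * m"
      using cu bound[of undefined] by (intro mult_right_mono) auto
    finally show ?thesis
      by (simp add: integral_along_first_def)
  qed
  have mem: "\<Phi> \<sigma> \<in> bcontfun" if "continuous_on UNIV \<sigma>" for \<sigma>
  proof (rule bcontfun_normI)
    have "continuous_on UNIV (\<lambda>x. G \<sigma> (cu (fst x), cv (snd x)))"
      by (rule continuous_on_compose2[OF contG[OF that]])
        (auto simp: cu_def cv_def intro!: continuous_intros)
    then show "continuous_on UNIV (\<Phi> \<sigma>)"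
      unfolding \<Phi>_def cv_def by (intro continuous_intros) (simp add: cv_def)
    show "norm (\<Phi> \<sigma> x) \<le> \<bar>v0\<bar> + d + d * m" for x
      using boundG[OF that, of "fst x" "cv (snd x)"] cv[of "snd x"] unfolding \<Phi>_def real_norm_def by linarith
  qed
  define T where "T \<sigma> = Bcontfun (\<Phi> (apply_bcontfun \<sigma>))" for \<sigma>
  have T: "apply_bcontfun (T \<sigma>) = \<Phi> (apply_bcontfun \<sigma>)" for \<sigma>
    unfolding T_def by (intro Bcontfun_inverse mem) auto
  have "dist (T \<sigma>) (T \<tau>) \<le> 1 / 2 * dist \<sigma> \<tau>" for \<sigma> \<tau>
  proof (rule dist_bound)
    fix x
    have "\<bar>G \<sigma> (cu (fst x), cv (snd x)) - G \<tau> (cu (fst x), cv (snd x))\<bar>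
        \<le> \<bar>cu (fst x) - u0\<bar> * (L * dist \<sigma> \<tau>)"
      unfolding G_def
    proof (rule integral_along_first_diff_bound[where U = UNIV and V = UNIV])
      fix t :: real
      let ?y = "(t :: real, cv (snd x))"
      have "\<bar>A (t, \<sigma> ?y) - A (t, \<tau> ?y)\<bar> \<le> L * \<bar>\<sigma> ?y - \<tau> ?y\<bar>"
        by (rule lipschitz)
      also have "\<dots> \<le> L * dist \<sigma> \<tau>"
        using dist_bounded[of \<sigma> ?y \<tau>] \<open>L \<ge> 0\<close> by (intro mult_left_mono) (auto simp: dist_real_def)
      finally show "\<bar>A (fst ?y, \<sigma> ?y) - A (fst ?y, \<tau> ?y)\<bar> \<le> L * dist \<sigma> \<tau>"
        by simp
    qed (use contA in auto)
    also have "\<dots> \<le> d * (L * dist \<sigma> \<tau>)"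
      using cu \<open>L \<ge> 0\<close> by (intro mult_right_mono) auto
    also have "\<dots> \<le> 1 / 2 * dist \<sigma> \<tau>"
      using mult_right_mono[OF assms(3), of "dist \<sigma> \<tau>"] by (simp add: mult.assoc)
    finally show "dist (T \<sigma> x) (T \<tau> x) \<le> 1 / 2 * dist \<sigma> \<tau>"
      by (simp add: T \<Phi>_def dist_real_def)
  qed
  then obtain \<sigma> where fixpoint: "T \<sigma> = \<sigma>"
    using banach_fix_type[of "1 / 2" T] by auto
  have \<sigma>: "\<sigma> (u, v) = v + G \<sigma> (u, v) \<and> \<bar>\<sigma> (u, v) - v\<bar> \<le> d * m"
    if "u \<in> {u0 - d<..<u0 + d}" "v \<in> {v0 - d<..<v0 + d}" for u v
  proof -
    have c: "cu u = u" "cv v = v"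
      unfolding cu_def cv_def using that by (auto intro!: max_min_eq)
    have "\<sigma> (u, v) = \<Phi> \<sigma> (u, v)"
      using T[of \<sigma>] by (simp add: fixpoint)
    then show ?thesis
      using boundG[of \<sigma> u v] by (simp add: \<Phi>_def c)
  qed
  show thesis
    by (rule that[of "apply_bcontfun \<sigma>"])
      (use \<sigma>[THEN conjunct1] \<sigma>[THEN conjunct2] in \<open>simp_all only: G_def continuous_on_apply_bcontfun\<close>)
qed

text \<open>
  A vector field given only near \<open>(u0, v0)\<close> is made bounded and globally Lipschitz by clamping its
  arguments to a square.  For short times the solution does not leave that square, where
  clamping has no effect.
\<close>

lemma scalar_ode_solution:
  fixes a :: "real \<times> real \<Rightarrow> real"
  assumes "open W" "smooth_on W a" "(u0, v0) \<in> W"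
  obtains d r \<sigma> where "d > 0" "{u0 - d<..<u0 + d} \<times> {v0 - r<..<v0 + r} \<subseteq> W"
    "continuous_on UNIV \<sigma>"
    "\<And>u v. u \<in> {u0 - d<..<u0 + d} \<Longrightarrow> v \<in> {v0 - d<..<v0 + d} \<Longrightarrow> \<sigma> (u, v) \<in> {v0 - r<..<v0 + r}"
    "\<And>u v. u \<in> {u0 - d<..<u0 + d} \<Longrightarrow> v \<in> {v0 - d<..<v0 + d} \<Longrightarrow>
      \<sigma> (u, v) = v + integral_along_first u0 (\<lambda>x. a (fst x, \<sigma> x)) (u, v)"
proof -
  obtain P Q where PQ: "open P" "open Q" "u0 \<in> P" "v0 \<in> Q" "P \<times> Q \<subseteq> W"
    using open_prod_elim[OF assms(1,3)] by (metis mem_Sigma_iff)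
  obtain r1 r2 where "r1 > 0" "cball u0 r1 \<subseteq> P" "r2 > 0" "cball v0 r2 \<subseteq> Q"
    using PQ open_contains_cball by metis
  define r where "r = min r1 r2"
  define U V where "U = {u0 - r..u0 + r}" and "V = {v0 - r..v0 + r}"
  have r: "r > 0" and "U \<subseteq> cball u0 r1" "V \<subseteq> cball v0 r2"
    using \<open>r1 > 0\<close> \<open>r2 > 0\<close> by (auto simp: r_def U_def V_def cball_eq_atLeastAtMost)
  then have UV: "U \<times> V \<subseteq> W"
    using PQ \<open>cball u0 r1 \<subseteq> P\<close> \<open>cball v0 r2 \<subseteq> Q\<close> by blast
  have cpt: "compact (U \<times> V)" and mid: "(u0, v0) \<in> U \<times> V"
    using r by (auto simp: U_def V_def intro!: compact_Times)
  let ?a' = "\<lambda>x. frechet_derivative a (at x) (0, 1)"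
  have ca: "continuous_on (U \<times> V) a" and ca': "continuous_on (U \<times> V) ?a'"
    using smooth_on_continuous_on smooth_on_frechet_derivative assms(2) UV continuous_on_subset by blast+
  obtain m where m: "\<And>x. x \<in> U \<times> V \<Longrightarrow> \<bar>a x\<bar> \<le> m"
    using compact_imp_bounded[OF compact_continuous_image[OF ca cpt]] by (auto simp: bounded_iff)
  obtain L where L: "\<And>x. x \<in> U \<times> V \<Longrightarrow> \<bar>?a' x\<bar> \<le> L"
    using compact_imp_bounded[OF compact_continuous_image[OF ca' cpt]] unfolding bounded_iff by auto
  have "m \<ge> 0" "L \<ge> 0"
    using m[OF mid] L[OF mid] by auto
  define cu where "cu t = max (u0 - r) (min (u0 + r) t)" for t
  define cv where "cv s = max (v0 - r) (min (v0 + r) s)" for s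
  have cuU: "cu t \<in> U" and cvV: "cv t \<in> V" for t
    unfolding cu_def cv_def U_def V_def using r by (auto intro!: max_min_mem simp del: atLeastAtMost_iff)
  define A where "A x = a (cu (fst x), cv (snd x))" for x
  \<comment> \<open>The first bound keeps the solution within \<open>r\<close> of \<open>v0\<close>, the second makes the Picard operator a contraction.\<close>
  define d where "d = min (r / (2 * (m + 1))) (1 / (2 * (L + 1)))"
  have "d > 0"
    using r \<open>m \<ge> 0\<close> \<open>L \<ge> 0\<close> by (simp add: d_def)
  have "d * (2 * (m + 1)) \<le> r"
  proof -
    have "d \<le> r / (2 * (m + 1))" by (simp add: d_def)
    then show ?thesis using \<open>m \<ge> 0\<close> by (simp add: pos_le_divide_eq)
  qed
  then have dm: "2 * d + 2 * (d * m) \<le> r"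
    by (simp add: algebra_simps)
  have dL: "d * L \<le> 1 / 2"
  proof -
    have "d \<le> 1 / (2 * (L + 1))" by (simp add: d_def)
    then have "d * (2 * (L + 1)) \<le> 1" using \<open>L \<ge> 0\<close> by (simp add: pos_le_divide_eq)
    then show ?thesis using \<open>d > 0\<close> by (simp add: algebra_simps)
  qed
  obtain \<sigma> where \<sigma>: "continuous_on UNIV \<sigma>"
    and fixpoint: "\<And>u v. u \<in> {u0 - d<..<u0 + d} \<Longrightarrow> v \<in> {v0 - d<..<v0 + d} \<Longrightarrow>
      \<sigma> (u, v) = v + integral_along_first u0 (\<lambda>x. A (fst x, \<sigma> x)) (u, v)"
    and near: "\<And>u v. u \<in> {u0 - d<..<u0 + d} \<Longrightarrow> v \<in> {v0 - d<..<v0 + d} \<Longrightarrow>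
      \<bar>\<sigma> (u, v) - v\<bar> \<le> d * m"
  proof (rule picard_fixed_point[of A d L m u0 v0])
    show "continuous_on UNIV A"
      unfolding A_def
      by (rule continuous_on_compose2[OF ca]) (use cuU cvV in \<open>auto simp: cu_def cv_def intro!: continuous_intros\<close>)
    show "\<bar>A x\<bar> \<le> m" for x
      using m cuU cvV by (simp add: A_def)
    show "\<bar>A (t, s) - A (t, s')\<bar> \<le> L * \<bar>s - s'\<bar>" for t s s'
    proof -
      have "norm (a (cu t, cv s) - a (cu t, cv s')) \<le> L * norm (cv s - cv s')"
      proof (rule field_differentiable_bound[of V _ "\<lambda>s. ?a' (cu t, s)"])
        show "((\<lambda>s. a (cu t, s)) has_real_derivative ?a' (cu t, z)) (at z within V)" if "z \<in> V" for z
          by (rule has_field_derivative_at_within, rule has_derivative_imp_second_partial,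
              rule smooth_on_has_derivative[OF assms(2)]) (use UV cuU that in auto)
      qed (use L cuU cvV in \<open>auto simp: V_def\<close>)
      also have "\<dots> \<le> L * \<bar>s - s'\<bar>"
        using max_min_contract \<open>L \<ge> 0\<close> by (auto simp: cv_def intro!: mult_left_mono)
      finally show ?thesis
        by (simp add: A_def)
    qed
  qed (use dL \<open>d > 0\<close> \<open>L \<ge> 0\<close> in auto)
  have dm0: "0 \<le> d * m"
    using \<open>d > 0\<close> \<open>m \<ge> 0\<close> by simp
  have dr: "d \<le> r"
    using dm dm0 \<open>d > 0\<close> by linarith
  have in_r: "\<sigma> (u, v) \<in> {v0 - r<..<v0 + r}"
    if "u \<in> {u0 - d<..<u0 + d}" "v \<in> {v0 - d<..<v0 + d}" for u v
    using near[OF that] that(2) dm dm0 \<open>d > 0\<close> by (simp add: abs_le_iff)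
  show thesis
  proof (rule that[of d r \<sigma>])
    show "{u0 - d<..<u0 + d} \<times> {v0 - r<..<v0 + r} \<subseteq> W"
      using UV dr by (force simp: U_def V_def)
    fix u v assume u: "u \<in> {u0 - d<..<u0 + d}" and v: "v \<in> {v0 - d<..<v0 + d}"
    have "integral_along_first u0 (\<lambda>x. A (fst x, \<sigma> x)) (u, v) = integral_along_first u0 (\<lambda>x. a (fst x, \<sigma> x)) (u, v)"
    proof (rule integral_along_first_cong)
      fix t assume t: "t \<in> {u0 - d<..<u0 + d}"
      then have "cu t = t"
        unfolding cu_def using dr by (intro max_min_eq) auto
      moreover have "cv (\<sigma> (t, v)) = \<sigma> (t, v)"
        unfolding cv_def using in_r[OF t v] by (intro max_min_eq) auto
      ultimately show "A (fst (t, v), \<sigma> (t, v)) = a (fst (t, v), \<sigma> (t, v))"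
        by (simp add: A_def)
    qed (use u in auto)
    with fixpoint[OF u v] show "\<sigma> (u, v) = v + integral_along_first u0 (\<lambda>x. a (fst x, \<sigma> x)) (u, v)"
      by simp
  qed (use \<sigma> in_r dr \<open>d > 0\<close> in auto)
qed

text \<open>
  For two solutions with initial values \<open>v\<close> and \<open>w\<close>, the difference satisfies a linear equation
  \<open>\<delta>' = b \<delta>\<close> whose coefficient \<open>b\<close> is the average of the partial derivative of \<open>a\<close> between them.
  Hence \<open>\<delta> = (w - v) exp(\<integral> b)\<close>.  This shows that solutions do not meet, and letting \<open>w\<close> tend to \<open>v\<close> it
  identifies the derivative in the initial value as
  \<open>e = exp(\<integral> a\<^sub>s(t, \<sigma>(t, v)) dt) > 0\<close>.  Now the full derivative of \<open>\<sigma>\<close> is expressed through \<open>\<sigma>\<close> itself, and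
  one order of differentiability of \<open>\<sigma>\<close> after the other follows.
\<close>

lemma smooth_scalar_flow:
  fixes a :: "real \<times> real \<Rightarrow> real"
  assumes "open W" "smooth_on W a" "(u0, v0) \<in> W"
  obtains d \<sigma> e Q where "d > 0" "Q = {u0 - d<..<u0 + d} \<times> {v0 - d<..<v0 + d}"
    "smooth_on Q \<sigma>" "smooth_on Q e" "\<And>x. x \<in> Q \<Longrightarrow> e x > 0"
    "\<And>x. x \<in> Q \<Longrightarrow> (fst x, \<sigma> x) \<in> W"
    "\<And>x. x \<in> Q \<Longrightarrow> (\<sigma> has_derivative (\<lambda>w. a (fst x, \<sigma> x) * fst w + e x * snd w)) (at x)"
    "\<sigma> (u0, v0) = v0"
    "\<And>u v v'. (u, v) \<in> Q \<Longrightarrow> (u, v') \<in> Q \<Longrightarrow> \<sigma> (u, v) = \<sigma> (u, v') \<Longrightarrow> v = v'"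
proof -
  obtain d r \<sigma> where "d > 0" and sub: "{u0 - d<..<u0 + d} \<times> {v0 - r<..<v0 + r} \<subseteq> W"
    and cont\<sigma>: "continuous_on UNIV \<sigma>"
    and in_r: "\<And>u v. u \<in> {u0 - d<..<u0 + d} \<Longrightarrow> v \<in> {v0 - d<..<v0 + d} \<Longrightarrow> \<sigma> (u, v) \<in> {v0 - r<..<v0 + r}"
    and sol: "\<And>u v. u \<in> {u0 - d<..<u0 + d} \<Longrightarrow> v \<in> {v0 - d<..<v0 + d} \<Longrightarrow>
      \<sigma> (u, v) = v + integral_along_first u0 (\<lambda>x. a (fst x, \<sigma> x)) (u, v)"
    by (rule scalar_ode_solution[OF assms], rule that)
  define U V R where "U = {u0 - d<..<u0 + d}" and "V = {v0 - d<..<v0 + d}" and "R = {v0 - r<..<v0 + r}"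
  note sub = sub[folded U_def V_def R_def] and in_r = in_r[folded U_def V_def R_def]
    and sol = sol[folded U_def V_def R_def]
  have UV: "open U" "open V" "convex U" "convex V" "convex R" "u0 \<in> U" "v0 \<in> V" "open (U \<times> V)"
    using \<open>d > 0\<close> by (auto simp: U_def V_def R_def intro: open_Times)
  define a' where "a' x = frechet_derivative a (at x) (0, 1)" for x
  have smooth_a': "smooth_on W a'"
    unfolding a'_def by (rule smooth_on_frechet_derivative[OF assms(2)])
  have cont_a: "continuous_on (U \<times> R) a" and cont_a': "continuous_on (U \<times> R) a'"
    using smooth_on_continuous_on assms(2) smooth_a' sub continuous_on_subset by blast+
  have cont\<sigma>S: "continuous_on S \<sigma>" for S
    using cont\<sigma> continuous_on_subset by blast
  note cont\<sigma>_compose = continuous_on_compose2[OF cont\<sigma>]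
  have cont_along: "continuous_on (U \<times> V) (\<lambda>x. b (fst x, \<sigma> x))" if "continuous_on (U \<times> R) b" for b :: "_ \<Rightarrow> real"
    by (rule continuous_on_compose2[OF that]) (use in_r cont\<sigma>S in \<open>auto intro!: continuous_intros\<close>)
  have start: "\<sigma> (u0, v) = v" if "v \<in> V" for v
    using sol[OF UV(6) that] by (simp add: integral_along_first_def)
  have d_u: "((\<lambda>u. \<sigma> (u, v)) has_real_derivative a (u, \<sigma> (u, v))) (at u)" if "u \<in> U" "v \<in> V" for u v
  proof (rule has_field_derivative_transform_within_open[where S = U])
    show "((\<lambda>u. v + integral_along_first u0 (\<lambda>x. a (fst x, \<sigma> x)) (u, v)) has_real_derivative a (u, \<sigma> (u, v))) (at u)"
      using integral_along_first_derivative[of u u0 d v V, folded U_def, OF that cont_along[OF cont_a]]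
      by (auto intro!: derivative_eq_intros)
  qed (use that UV sol in auto)

  \<comment> \<open>The parameter of \<open>b\<close> is the pair of initial values of the two solutions being compared.\<close>
  define b where "b x = integral {0..1} (\<lambda>\<xi>. a' (fst x, \<sigma> (fst x, fst (snd x)) +
      \<xi> * (\<sigma> (fst x, snd (snd x)) - \<sigma> (fst x, fst (snd x)))))" for x :: "real \<times> real \<times> real"
  have cont_b: "continuous_on (U \<times> V \<times> V) b"
  proof -
    have "continuous_on ((U \<times> V \<times> V) \<times> cbox 0 1) (\<lambda>(x, \<xi>). a' (fst x, \<sigma> (fst x, fst (snd x)) +
      \<xi> * (\<sigma> (fst x, snd (snd x)) - \<sigma> (fst x, fst (snd x)))))"
      unfolding case_prod_beta'
      by (rule continuous_on_compose2[OF cont_a'])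
        (auto intro!: continuous_intros cont\<sigma>_compose segment_in_convex[OF UV(5)] in_r)
    from integral_continuous_on_param[OF this] show ?thesis
      unfolding b_def by simp
  qed
  have divided: "a (t, \<sigma> (t, w)) - a (t, \<sigma> (t, v)) = (\<sigma> (t, w) - \<sigma> (t, v)) * b (t, v, w)"
    if "t \<in> U" "v \<in> V" "w \<in> V" for t v w
  proof -
    have "a (t, \<sigma> (t, w)) - a (t, \<sigma> (t, v)) = (\<sigma> (t, w) - \<sigma> (t, v)) *
        integral {0..1} (\<lambda>\<theta>. a' (t, \<sigma> (t, v) + \<theta> * (\<sigma> (t, w) - \<sigma> (t, v))))"
    proof (rule difference_eq_integral_derivative[OF UV(5), of _ _ "\<lambda>s. a (t, s)" "\<lambda>s. a' (t, s)"])
      show "((\<lambda>s. a (t, s)) has_real_derivative a' (t, s)) (at s)" if "s \<in> R" for s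
        unfolding a'_def
        by (rule has_derivative_imp_second_partial, rule smooth_on_has_derivative[OF assms(2)])
          (use sub \<open>t \<in> U\<close> that in auto)
    qed (use that in_r in auto)
    then show ?thesis
      by (simp add: b_def)
  qed
  define B where "B = integral_along_first u0 b"
  have cont_B: "continuous_on (U \<times> V \<times> V) B"
    unfolding B_def by (rule continuous_on_integral_along_first[OF UV(3,6) cont_b])
  have spread: "\<sigma> (u, w) - \<sigma> (u, v) = (w - v) * exp (B (u, v, w))"
    if u: "u \<in> U" and v: "v \<in> V" and w: "w \<in> V" for u v w
  proof -
    \<comment> \<open>The solution of the linear equation, divided by the expected exponential, is constant.\<close>
    define g where "g t = (\<sigma> (t, w) - \<sigma> (t, v)) * exp (- B (t, v, w))" for t
    have "(g has_real_derivative 0) (at t)" if t: "t \<in> U" for t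
    proof -
      have "((\<lambda>t. B (t, v, w)) has_real_derivative b (t, v, w)) (at t)"
        using integral_along_first_derivative[of t u0 d "(v, w)" "V \<times> V" b] t v w cont_b
        by (auto simp: B_def U_def)
      moreover have "((\<lambda>t. \<sigma> (t, w) - \<sigma> (t, v)) has_real_derivative
          (\<sigma> (t, w) - \<sigma> (t, v)) * b (t, v, w)) (at t)"
        using DERIV_diff[OF d_u[OF t w] d_u[OF t v]] divided[OF t v w] by simp
      ultimately have "(g has_real_derivative ((\<sigma> (t, w) - \<sigma> (t, v)) * b (t, v, w)) * exp (- B (t, v, w)) +
          (exp (- B (t, v, w)) * (- b (t, v, w))) * (\<sigma> (t, w) - \<sigma> (t, v))) (at t)"
        unfolding g_def by (intro DERIV_mult DERIV_fun_exp DERIV_minus)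
      then show ?thesis
        by (simp add: algebra_simps)
    qed
    then have "g u = g u0"
      using u UV(6) unfolding U_def
      by (intro DERIV_isconst3[of "u0 - d" "u0 + d"]) (use \<open>d > 0\<close> in auto)
    then have "(\<sigma> (u, w) - \<sigma> (u, v)) * exp (- B (u, v, w)) = w - v"
      by (simp add: g_def start v w B_def integral_along_first_def)
    then show ?thesis
      by (simp add: exp_minus field_simps)
  qed
  define e where "e x = exp (integral_along_first u0 (\<lambda>x. a' (fst x, \<sigma> x)) x)" for x
  have d_v: "((\<lambda>v. \<sigma> (u, v)) has_real_derivative e (u, v)) (at v)" if u: "u \<in> U" and v: "v \<in> V" for u v
  proof -
    have "B (u, v, v) = integral_along_first u0 (\<lambda>x. a' (fst x, \<sigma> x)) (u, v)"
      unfolding B_def integral_along_first_def by (simp add: b_def)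
    moreover have "continuous_on V (\<lambda>w. exp (B (u, v, w)))"
      by (intro continuous_intros continuous_on_compose2[OF cont_B]) (use u v in auto)
    then have "((\<lambda>w. exp (B (u, v, w))) \<longlongrightarrow> exp (B (u, v, v))) (at v)"
      using v UV(2) by (simp add: continuous_on_eq_continuous_at isCont_def)
    then have "((\<lambda>w. (\<sigma> (u, w) - \<sigma> (u, v)) / (w - v)) \<longlongrightarrow> exp (B (u, v, v))) (at v)"
      by (rule Lim_transform_within_open[OF _ UV(2) v]) (use spread u v in auto)
    ultimately show ?thesis
      by (simp add: has_field_derivative_iff e_def)
  qed
  have cont_e: "continuous_on (U \<times> V) e"
    unfolding e_def
    by (intro continuous_intros continuous_on_integral_along_first[OF UV(3,6)] cont_along cont_a')
  have D: "(\<sigma> has_derivative (\<lambda>w. a (fst x, \<sigma> x) * fst w + e x * snd w)) (at x)" if "x \<in> U \<times> V" for x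
    using has_derivative_from_partials[OF UV(1,2,4), of "fst x" "snd x" \<sigma> _ e] that d_u d_v cont_e
    by auto
  have along: "times_differentiable_on n (U \<times> V) (\<lambda>x. c (fst x, \<sigma> x))"
    if "smooth_on W c" "times_differentiable_on n (U \<times> V) \<sigma>" for c :: "_ \<Rightarrow> real" and n
    by (rule times_differentiable_on_compose[OF UV(8) assms(1)])
      (use that in_r sub in \<open>auto intro!: times_differentiable_on_intros UV(8) simp: smooth_on_def\<close>)
  have e_n: "times_differentiable_on n (U \<times> V) e" if "times_differentiable_on n (U \<times> V) \<sigma>" for n
    unfolding e_def U_def
    by (intro times_differentiable_on_exp times_differentiable_on_integral_along_first)
      (use UV along[OF smooth_a' that] in \<open>simp_all add: U_def\<close>)
  have \<sigma>_n: "times_differentiable_on n (U \<times> V) \<sigma>" for n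
  proof (induction n)
    case 0
    then show ?case by (simp add: cont\<sigma>S)
  next
    case (Suc n)
    have "times_differentiable_on n (U \<times> V) (\<lambda>x. a (fst x, \<sigma> x))"
      by (rule along[OF assms(2) Suc])
    then show ?case
      by (intro times_differentiable_on_SucI[OF UV(8) D] times_differentiable_on_intros UV(8) e_n Suc)
  qed
  show thesis
  proof (rule that[of d "U \<times> V" \<sigma> e])
    show "v = v'" if "(u, v) \<in> U \<times> V" "(u, v') \<in> U \<times> V" "\<sigma> (u, v) = \<sigma> (u, v')" for u v v'
      using spread[of u v v'] that by simp
    show "(fst x, \<sigma> x) \<in> W" if "x \<in> U \<times> V" for x
      using that in_r sub by auto
    show "smooth_on (U \<times> V) \<sigma>" "smooth_on (U \<times> V) e"
      using \<sigma>_n e_n by (auto simp: smooth_on_def)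
  qed (use \<open>d > 0\<close> D start UV in \<open>auto simp: U_def V_def e_def\<close>)
qed

section \<open>Local parametrizations and tangent planes\<close>

lemma local_param_smooth: "local_param M F W \<kappa> \<Longrightarrow> smooth_on W (F \<circ> \<kappa>)"
  and local_param_open: "local_param M F W \<kappa> \<Longrightarrow> open W"
  and local_param_inj: "local_param M F W \<kappa> \<Longrightarrow> w \<in> W \<Longrightarrow> inj (frechet_derivative (F \<circ> \<kappa>) (at w))"
  and local_param_openin: "local_param M F W \<kappa> \<Longrightarrow> openin (top_of_set M) (\<kappa> ` W)"
  by (auto simp: local_param_def)

lemma local_param_mem: "local_param M F W \<kappa> \<Longrightarrow> w \<in> W \<Longrightarrow> \<kappa> w \<in> M"
  using local_param_openin openin_imp_subset by blast

lemma local_param_derivative: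
  "local_param M F W \<kappa> \<Longrightarrow> w \<in> W \<Longrightarrow>
    (F \<circ> \<kappa> has_derivative frechet_derivative (F \<circ> \<kappa>) (at w)) (at w)"
  by (rule smooth_on_has_derivative[OF local_param_smooth])

text \<open>
  The transition map between two parametrizations is differentiable, because it can be written
  with maps on coordinate domains only: a linear left inverse \<open>L\<close> of the derivative turns the
  first parametrization into a local diffeomorphism \<open>f = L \<circ> \<psi>\<close> of the plane, and the transition
  map is the inverse of \<open>f\<close> after \<open>L \<circ> \<psi>'\<close>.  The chain rule then factors the derivative
  of \<open>\<psi>'\<close> through that of \<open>\<psi>\<close>.
\<close>

lemma local_param_range_subset:
  fixes F :: "'m::topological_space \<Rightarrow> 'e::euclidean_space" and W W' :: "(real \<times> real) set"
  assumes p: "local_param M F W \<kappa>" and p': "local_param M F W' \<kappa>'"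
    and w: "w \<in> W" and w': "w' \<in> W'" and eq: "\<kappa> w = \<kappa>' w'"
  shows "range (frechet_derivative (F \<circ> \<kappa>') (at w')) \<subseteq> range (frechet_derivative (F \<circ> \<kappa>) (at w))"
proof -
  define \<psi> \<psi>' where "\<psi> = F \<circ> \<kappa>" and "\<psi>' = F \<circ> \<kappa>'"
  define D where "D = frechet_derivative \<psi> (at w)"
  have D: "(\<psi> has_derivative D) (at w)" and injD: "inj D"
    using local_param_derivative[OF p w] local_param_inj[OF p w] by (auto simp: D_def \<psi>_def)
  have "linear D"
    by (rule bounded_linear.linear[OF has_derivative_bounded_linear[OF D]])
  then obtain L where "linear L" and LD: "L \<circ> D = id"
    using linear_injective_left_inverse injD by blast
  then have L: "bounded_linear L"
    by (simp add: linear_conv_bounded_linear)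
  define f where "f w = L (\<psi> w)" for w
  have "open W" "open W'"
    using p p' local_param_open by blast+
  have smooth_f: "smooth_on W f"
    using times_differentiable_on_bounded_linear[OF \<open>open W\<close> L] local_param_smooth[OF p]
    unfolding smooth_on_def f_def \<psi>_def comp_def by blast
  obtain f' where f': "continuous_on W f'" "\<And>x. x \<in> W \<Longrightarrow> blinfun_apply (f' x) = frechet_derivative f (at x)"
    using smooth_on_continuous_blinfun[OF smooth_f] by blast
  have df: "(f has_derivative blinfun_apply (f' x)) (at x)" if "x \<in> W" for x
    using smooth_on_has_derivative[OF smooth_f that] f'(2)[OF that] by simp
  have "(f has_derivative (\<lambda>v. L (D v))) (at w)"
    unfolding f_def by (rule bounded_linear.has_derivative[OF L D])
  then have "blinfun_apply (f' w) = id"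
    using has_derivative_unique[OF df[OF w]] LD by (simp add: comp_def)
  then have inv: "id_blinfun o\<^sub>L f' w = id_blinfun"
    by (intro blinfun_eqI) simp
  obtain U' V g g' where U': "open U'" "U' \<subseteq> W" "w \<in> U'" and V: "f w \<in> V"
    and hom: "homeomorphism U' V f g" and dg: "\<And>y. y \<in> V \<Longrightarrow> (g has_derivative g' y) (at y)"
    by (rule inverse_function_theorem[OF \<open>open W\<close> df f'(1) w inv], assumption, rule that)
  obtain \<kappa>i where homW: "homeomorphism W (\<kappa> ` W) \<kappa> \<kappa>i"
    using p unfolding local_param_def by blast
  have "openin (top_of_set (\<kappa> ` W)) (\<kappa> ` U')"
    using homeomorphism_imp_open_map[OF homW] U' \<open>open W\<close> openin_open_eq by blast
  then have "openin (top_of_set M) (\<kappa> ` U')"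
    using local_param_openin[OF p] openin_trans by blast
  moreover have "continuous_on W' \<kappa>'" and "\<kappa>' \<in> W' \<rightarrow> M"
    using p' local_param_mem[OF p'] unfolding local_param_def homeomorphism_def by auto
  ultimately have "openin (top_of_set W') (W' \<inter> \<kappa>' -` (\<kappa> ` U'))"
    by (intro continuous_openin_preimage)
  then have openN: "open (W' \<inter> \<kappa>' -` (\<kappa> ` U'))"
    using \<open>open W'\<close> openin_open_eq by blast
  have fact: "\<psi> (g (L (\<psi>' x))) = \<psi>' x" if x: "x \<in> W' \<inter> \<kappa>' -` (\<kappa> ` U')" for x
  proof -
    obtain y where y: "y \<in> U'" "\<kappa>' x = \<kappa> y"
      using x by blast
    then have "L (\<psi>' x) = f y"
      by (simp add: f_def \<psi>_def \<psi>'_def)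
    then have "g (L (\<psi>' x)) = y"
      using hom y(1) by (simp add: homeomorphism_def)
    then show ?thesis
      using y(2) by (simp add: \<psi>_def \<psi>'_def)
  qed
  have at_w': "L (\<psi>' w') = f w" "g (f w) = w"
    using eq hom U'(3) by (auto simp: f_def \<psi>_def \<psi>'_def homeomorphism_def)
  have D': "(\<psi>' has_derivative frechet_derivative \<psi>' (at w')) (at w')"
    using local_param_derivative[OF p' w'] by (simp add: \<psi>'_def)
  have "((\<lambda>x. L (\<psi>' x)) has_derivative (\<lambda>v. L (frechet_derivative \<psi>' (at w') v))) (at w')"
    by (rule bounded_linear.has_derivative[OF L D'])
  from has_derivative_compose[OF this, of g "g' (f w)"]
  have "((\<lambda>x. g (L (\<psi>' x))) has_derivative (\<lambda>v. g' (f w) (L (frechet_derivative \<psi>' (at w') v)))) (at w')"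
    using dg[OF V] at_w' by simp
  from has_derivative_compose[OF this, of \<psi> D]
  have "((\<lambda>x. \<psi> (g (L (\<psi>' x)))) has_derivative
      (\<lambda>v. D (g' (f w) (L (frechet_derivative \<psi>' (at w') v))))) (at w')"
    using D at_w' by simp
  then have "(\<psi>' has_derivative (\<lambda>v. D (g' (f w) (L (frechet_derivative \<psi>' (at w') v))))) (at w')"
    by (rule has_derivative_transform_within_open[OF _ openN]) (use w' U'(3) eq fact in \<open>auto simp flip: eq\<close>)
  from has_derivative_unique[OF D' this] show ?thesis
    unfolding D_def[symmetric] \<psi>_def[symmetric] \<psi>'_def[symmetric]
    by (metis rangeI image_subsetI)
qed

lemma tangent_plane_eq_range:
  fixes F :: "'m::topological_space \<Rightarrow> 'e::euclidean_space" and W :: "(real \<times> real) set"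
  assumes "local_param M F W \<kappa>" "w \<in> W"
  shows "tangent_plane M F (\<kappa> w) = range (frechet_derivative (F \<circ> \<kappa>) (at w))"
proof
  show "tangent_plane M F (\<kappa> w) \<subseteq> range (frechet_derivative (F \<circ> \<kappa>) (at w))"
    unfolding tangent_plane_def using local_param_range_subset[OF assms(1) _ assms(2)] by fastforce
  show "range (frechet_derivative (F \<circ> \<kappa>) (at w)) \<subseteq> tangent_plane M F (\<kappa> w)"
    unfolding tangent_plane_def using assms by blast
qed

text \<open>
  Invariance of domain makes an injective continuous change of coordinates a homeomorphism onto
  an open set, so that only its derivative has to be examined.
\<close>

lemma local_param_compose:
  fixes F :: "'m::topological_space \<Rightarrow> 'e::real_normed_vector" and W V :: "(real \<times> real) set"
  assumes p: "local_param M F W \<kappa>" and "open V" "\<tau> ` V \<subseteq> W" "inj_on \<tau> V" "smooth_on V \<tau>"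
    and inj: "\<And>y. y \<in> V \<Longrightarrow> inj (frechet_derivative \<tau> (at y))"
  shows "local_param M F V (\<kappa> \<circ> \<tau>)"
proof -
  obtain \<kappa>i where homW: "homeomorphism W (\<kappa> ` W) \<kappa> \<kappa>i"
    using p unfolding local_param_def by blast
  have cont: "continuous_on V \<tau>"
    by (rule smooth_on_continuous_on) fact
  obtain \<tau>i where hom: "homeomorphism V (\<tau> ` V) \<tau> \<tau>i"
    by (rule invariance_of_domain_homeomorphism[OF \<open>open V\<close> cont _ \<open>inj_on \<tau> V\<close>]) auto
  have "open (\<tau> ` V)"
    by (rule invariance_of_domain[OF cont \<open>open V\<close> \<open>inj_on \<tau> V\<close>])
  then have "openin (top_of_set (\<kappa> ` W)) (\<kappa> ` \<tau> ` V)"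
    using homeomorphism_imp_open_map[OF homW] assms(3) openin_open_eq[OF local_param_open[OF p]] by blast
  then have "openin (top_of_set M) ((\<kappa> \<circ> \<tau>) ` V)"
    using local_param_openin[OF p] openin_trans by (auto simp: image_comp)
  moreover have "homeomorphism (\<tau> ` V) (\<kappa> ` \<tau> ` V) \<kappa> \<kappa>i"
    by (rule homeomorphism_of_subsets[OF homW assms(3)]) (use assms(3) in auto)
  then have "homeomorphism V ((\<kappa> \<circ> \<tau>) ` V) (\<kappa> \<circ> \<tau>) (\<tau>i \<circ> \<kappa>i)"
    using homeomorphism_compose[OF hom] by (simp only: image_comp)
  moreover have "smooth_on V (F \<circ> (\<kappa> \<circ> \<tau>))"
    using smooth_on_compose[OF \<open>open V\<close> local_param_open[OF p] assms(5,3) local_param_smooth[OF p]]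
    by (simp add: comp_def)
  moreover have "inj (frechet_derivative (F \<circ> (\<kappa> \<circ> \<tau>)) (at y))" if y: "y \<in> V" for y
  proof -
    have Wy: "\<tau> y \<in> W" using assms(3) y by blast
    have "frechet_derivative ((F \<circ> \<kappa>) \<circ> \<tau>) (at y) =
        frechet_derivative (F \<circ> \<kappa>) (at (\<tau> y)) \<circ> frechet_derivative \<tau> (at y)"
      using smooth_on_has_derivative[OF assms(5) y] local_param_derivative[OF p Wy]
      by (intro frechet_derivative_compose) (auto simp: differentiable_def)
    then show ?thesis
      using inj_compose[OF local_param_inj[OF p Wy] inj[OF y]] by (simp add: comp_assoc)
  qed
  ultimately show ?thesis
    using \<open>open V\<close> unfolding local_param_def by blast
qed

text \<open>
  An immersion is injective near each point, and on a compact ball continuity of the inverse is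
  automatic.
\<close>

lemma immersion_locally_homeomorphism:
  fixes \<phi> :: "'a::euclidean_space \<Rightarrow> 'b::euclidean_space"
  assumes "open W" "smooth_on W \<phi>" "w \<in> W" "inj (frechet_derivative \<phi> (at w))"
  obtains r \<phi>' where "r > 0" "ball w r \<subseteq> W" "homeomorphism (ball w r) (\<phi> ` ball w r) \<phi> \<phi>'"
proof -
  obtain \<phi>' where \<phi>': "continuous_on W \<phi>'" "\<And>x. x \<in> W \<Longrightarrow> blinfun_apply (\<phi>' x) = frechet_derivative \<phi> (at x)"
    using smooth_on_continuous_blinfun[OF assms(2)] by blast
  have d: "(\<phi> has_derivative blinfun_apply (\<phi>' x)) (at x)" if "x \<in> W" for x
    using smooth_on_has_derivative[OF assms(2) that] \<phi>'(2)[OF that] by simp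
  obtain L where "linear L" and L: "L \<circ> \<phi>' w = id"
    using linear_injective_left_inverse[of "blinfun_apply (\<phi>' w)"] assms(4) \<phi>'(2)[OF assms(3)]
      bounded_linear.linear[OF blinfun.bounded_linear_right] by metis
  then have "bounded_linear L"
    by (simp add: linear_conv_bounded_linear)
  have near: "\<exists>d>0. \<forall>x. dist w x < d \<longrightarrow> onorm (\<lambda>v. \<phi>' x v - \<phi>' w v) < e"
    if e: "e > 0" for e
  proof -
    have "isCont \<phi>' w"
      using \<phi>'(1) assms(1,3) continuous_on_eq_continuous_at by blast
    then obtain d where "d > 0" "\<And>x. dist w x < d \<Longrightarrow> dist (\<phi>' x) (\<phi>' w) < e"
      using e unfolding continuous_at_eps_delta by (metis dist_commute)
    then show ?thesis
      by (intro exI[of _ d]) (auto simp: dist_norm norm_blinfun.rep_eq minus_blinfun.rep_eq)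
  qed
  obtain r where r: "r > 0" "ball w r \<subseteq> W" "inj_on \<phi> (ball w r)"
    by (rule has_derivative_locally_injective[OF assms(3,1) \<open>bounded_linear L\<close> L d near],
        assumption, assumption, rule that)
  \<comment> \<open>Half the radius gives a compact ball inside the ball of injectivity.\<close>
  have sub: "cball w (r / 2) \<subseteq> ball w r"
    using r(1) by auto
  have "continuous_on (cball w (r / 2)) \<phi>"
    using smooth_on_continuous_on[OF assms(2)] sub r(2) continuous_on_subset by (metis subset_trans)
  then obtain \<phi>i where "homeomorphism (cball w (r / 2)) (\<phi> ` cball w (r / 2)) \<phi> \<phi>i"
    using homeomorphism_compact[of "cball w (r / 2)" \<phi>] inj_on_subset[OF r(3) sub] by auto
  then have "homeomorphism (ball w (r / 2)) (\<phi> ` ball w (r / 2)) \<phi> \<phi>i"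
    by (rule homeomorphism_of_subsets) auto
  moreover have "ball w (r / 2) \<subseteq> W"
    using r by (auto intro: less_trans)
  ultimately show thesis
    using that[of "r / 2" \<phi>i] r(1) by auto
qed

text \<open>
  The function \<open>h\<close> is completed to a coordinate system by the linear function whose gradient is
  the gradient of \<open>h\<close> at \<open>w0\<close> turned by a right angle.  The Jacobian determinant is then the inner
  product of the gradients of \<open>h\<close> at \<open>x\<close> and at \<open>w0\<close>, so it is positive near \<open>w0\<close> whichever partial
  derivative is nonzero.
\<close>

lemma level_set_coordinates:
  fixes h :: "real \<times> real \<Rightarrow> real"
  assumes "open W" "smooth_on W h" "w0 \<in> W" "frechet_derivative h (at w0) v0 \<noteq> 0"
  obtains V and H :: "real \<times> real \<Rightarrow> real \<times> real" where "open V" "w0 \<in> H ` V" "H ` V \<subseteq> W" "inj_on H V" "smooth_on V H"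
    "\<And>y. y \<in> V \<Longrightarrow> h (H y) = fst y" "\<And>y. y \<in> V \<Longrightarrow> inj (frechet_derivative H (at y))"
proof -
  define p q where "p x = frechet_derivative h (at x) (1, 0)" and "q x = frechet_derivative h (at x) (0, 1)" for x
  have smooth_pq: "smooth_on W p" "smooth_on W q"
    unfolding p_def q_def by (intro smooth_on_frechet_derivative assms)+
  have dh: "(h has_derivative (\<lambda>v. p x * fst v + q x * snd v)) (at x)" if "x \<in> W" for x
  proof -
    have D: "(h has_derivative frechet_derivative h (at x)) (at x)"
      by (rule smooth_on_has_derivative[OF assms(2) that])
    have "linear (frechet_derivative h (at x))"
      by (rule bounded_linear.linear[OF has_derivative_bounded_linear[OF D]])
    from linear_add[OF this] linear_cmul[OF this]
    have "frechet_derivative h (at x) (fst v *\<^sub>R (1, 0) + snd v *\<^sub>R (0, 1)) = fst v * p x + snd v * q x" for v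
      by (simp only: p_def q_def real_scaleR_def)
    then have "frechet_derivative h (at x) = (\<lambda>v. p x * fst v + q x * snd v)"
      by (simp add: fun_eq_iff mult.commute)
    with D show ?thesis by simp
  qed
  define p0 q0 where "p0 = p w0" and "q0 = q w0"
  define det where "det x = p x * p0 + q x * q0" for x
  define W1 where "W1 = {x \<in> W. det x > 0}"
  have smooth_det: "smooth_on W det"
    using smooth_pq assms(1) unfolding smooth_on_def det_def
    by (auto intro!: times_differentiable_on_intros)
  have "p0 \<noteq> 0 \<or> q0 \<noteq> 0"
    using assms(4) frechet_derivative_at[OF dh[OF assms(3)], symmetric] by (auto simp: p0_def q0_def)
  then have \<Delta>: "p0 * p0 + q0 * q0 > 0"
    by (auto simp: sum_squares_gt_zero_iff)
  then have w0: "w0 \<in> W1"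
    using assms(3) by (simp add: W1_def det_def p0_def q0_def)
  have "open (W \<inter> det -` {0<..})"
    by (rule continuous_open_preimage[OF smooth_on_continuous_on[OF smooth_det] assms(1)]) auto
  then have openW1: "open W1"
    by (simp add: W1_def vimage_def Int_def)
  define G where "G x = (h x, p0 * snd x - q0 * fst x)" for x
  have smoothG: "smooth_on W1 G"
    using assms(2) smooth_on_subset[of W h W1] openW1
    unfolding smooth_on_def G_def W1_def
    by (auto intro!: times_differentiable_on_intros)
  have dG: "(G has_derivative (\<lambda>v. (p x * fst v + q x * snd v, p0 * snd v - q0 * fst v))) (at x)"
    if "x \<in> W1" for x
    unfolding G_def using that
    by (auto intro!: derivative_eq_intros dh simp: W1_def)
  obtain G' where G': "continuous_on W1 G'" "\<And>x. x \<in> W1 \<Longrightarrow> blinfun_apply (G' x) = frechet_derivative G (at x)"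
    using smooth_on_continuous_blinfun[OF smoothG] by blast
  have G'_eq: "blinfun_apply (G' x) = (\<lambda>v. (p x * fst v + q x * snd v, p0 * snd v - q0 * fst v))" if "x \<in> W1" for x
    using G'(2)[OF that] frechet_derivative_at[OF dG[OF that]] by simp
  \<comment> \<open>The inverse of the Jacobian matrix by Cramer's rule.\<close>
  define inverse_at where "inverse_at x v =
    ((p0 * fst v - q x * snd v) / det x, (q0 * fst v + p x * snd v) / det x)" for x and v :: "real \<times> real"
  have left: "inverse_at x (G' x v) = v" and right: "G' x (inverse_at x v) = v" if "x \<in> W1" for x v
  proof -
    have "det x \<noteq> 0" using that by (simp add: W1_def)
    then show "inverse_at x (G' x v) = v" "G' x (inverse_at x v) = v"
      using that by (simp_all add: G'_eq inverse_at_def prod_eq_iff divide_simps)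
        (simp_all add: det_def algebra_simps)
  qed
  have "linear (inverse_at w0)"
    by (rule linearI) (auto simp: inverse_at_def algebra_simps add_divide_distrib diff_divide_distrib)
  then have "blinfun_apply (Blinfun (inverse_at w0)) = inverse_at w0"
    by (simp add: bounded_linear_Blinfun_apply linear_conv_bounded_linear)
  then have inv: "Blinfun (inverse_at w0) o\<^sub>L G' w0 = id_blinfun"
    using left[OF w0] by (intro blinfun_eqI) simp
  have dG': "(G has_derivative blinfun_apply (G' x)) (at x)" if "x \<in> W1" for x
    using dG[OF that] G'_eq[OF that] by simp
  obtain U' V H H' where U': "U' \<subseteq> W1" "w0 \<in> U'" and V: "open V" "G w0 \<in> V"
    and hom: "homeomorphism U' V G H" and dH: "\<And>y. y \<in> V \<Longrightarrow> (H has_derivative H' y) (at y)"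
    and H': "\<And>y. y \<in> V \<Longrightarrow> H' y = inv (blinfun_apply (G' (H y)))"
    by (rule inverse_function_theorem[OF openW1 dG' G'(1) w0 inv], assumption, rule that)
  have HV: "H y \<in> U'" "G (H y) = y" if "y \<in> V" for y
    using hom that by (auto simp: homeomorphism_def)
  then have HW1: "H ` V \<subseteq> W1"
    using U' by blast
  have H'_eq: "H' y = inverse_at (H y)" if "y \<in> V" for y
    unfolding H'[OF that]
    by (rule inv_equality) (use HW1 that left right in blast)+
  have inj_H': "inj (H' y)" if "y \<in> V" for y
    using right[of "H y"] HV[OF that] U' unfolding H'_eq[OF that] by (metis injI subsetD)
  \<comment> \<open>The derivative of the inverse map is a rational expression in smooth functions composed with the inverse map.\<close>
  have "times_differentiable_on n V H" for n
  proof (induction n)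
    case 0
    then show ?case using hom by (simp add: homeomorphism_def)
  next
    case (Suc n)
    have comp: "times_differentiable_on n V (\<lambda>y. c (H y))" if "smooth_on W c" for c :: "_ \<Rightarrow> real"
      by (rule times_differentiable_on_compose[OF V(1) openW1 Suc HW1])
        (use smooth_on_subset[OF that, of W1] in \<open>auto simp: smooth_on_def W1_def\<close>)
    show ?case
    proof (rule times_differentiable_on_SucI[OF V(1)])
      show "(H has_derivative inverse_at (H y)) (at y)" if "y \<in> V" for y
        using dH[OF that] H'_eq[OF that] by simp
      show "times_differentiable_on n V (\<lambda>y. inverse_at (H y) v)" for v
        unfolding inverse_at_def using HW1
        by (intro times_differentiable_on_intros V(1) comp smooth_pq smooth_det) (auto simp: W1_def)
    qed
  qed
  then have smoothH: "smooth_on V H"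
    by (simp add: smooth_on_def)
  show thesis
  proof (rule that[of V H])
    show "w0 \<in> H ` V"
      using hom U' by (auto simp: homeomorphism_def)
    show "inj_on H V"
      using HV(2) by (metis inj_onI)
    show "h (H y) = fst y" if "y \<in> V" for y
      using HV(2)[OF that] by (metis G_def fst_conv)
    show "inj (frechet_derivative H (at y))" if "y \<in> V" for y
      using inj_H'[OF that] frechet_derivative_at[OF dH[OF that]] by simp
  qed (use V HW1 smoothH in \<open>auto simp: W1_def\<close>)
qed

section \<open>Tangential parts in Lorentzian planes\<close>

lemma lorentzian_plane_nondegenerate:
  assumes lin: "\<And>x. linear (g x)" and sym: "\<And>x y. g x y = g y x"
    and "lorentzian_plane g V" "T \<in> V" "\<And>Y. Y \<in> V \<Longrightarrow> g T Y = 0"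
  shows "T = 0"
proof -
  obtain e0 e1 where V: "V = span {e0, e1}" and e: "g e0 e0 = -1" "g e0 e1 = 0" "g e1 e1 = 1"
    using assms(3) unfolding lorentzian_plane_def by blast
  obtain a b where T: "T = a *\<^sub>R e0 + b *\<^sub>R e1"
    using assms(4) by (auto simp: V span_insert span_singleton) (metis add_diff_cancel_left' add.commute diff_add_cancel)
  have "g e0 T = - a" "g e1 T = b"
    using e sym[of e1 e0] by (auto simp: T linear_add[OF lin] linear_cmul[OF lin])
  moreover have "g e0 T = 0" "g e1 T = 0"
    using assms(5)[of e0] assms(5)[of e1] sym by (auto simp: V span_base)
  ultimately show ?thesis
    by (simp add: T)
qed

text \<open>
  In a Lorentzian basis the orthogonal projection is \<open>- g(X, e\<^sub>0) e\<^sub>0 + g(X, e\<^sub>1) e\<^sub>1\<close>, and it is the only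
  candidate because the plane is nondegenerate.  So the description of the tangential part is
  satisfied and determines it.
\<close>

lemma tangential_part_lorentzian:
  assumes lin: "\<And>x. linear (g x)" and sym: "\<And>x y. g x y = g y x" and V: "lorentzian_plane g V"
  shows "tangential_part g V X \<in> V"
    and "Y \<in> V \<Longrightarrow> g (tangential_part g V X) Y = g X Y"
    and "T \<in> V \<Longrightarrow> (\<And>Y. Y \<in> V \<Longrightarrow> g T Y = g X Y) \<Longrightarrow> tangential_part g V X = T"
proof -
  have diff: "g (x - y) z = g x z - g y z" for x y z
    using linear_diff[OF lin, of z x y] sym by simp
  obtain e0 e1 where V_def: "V = span {e0, e1}" and e: "g e0 e0 = -1" "g e0 e1 = 0" "g e1 e1 = 1"
    using V unfolding lorentzian_plane_def by blast
  define S where "S = (- g X e0) *\<^sub>R e0 + g X e1 *\<^sub>R e1"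
  have S: "S \<in> V"
    unfolding S_def V_def by (intro span_add span_scale span_base) auto
  have "g S Y = g X Y" if Y: "Y \<in> V" for Y
  proof -
    have *: "g Y S = - g X e0 * g Y e0 + g X e1 * g Y e1" for Y
      by (simp add: S_def linear_add[OF lin] linear_cmul[OF lin] linear_diff[OF lin])
    have "g S e0 = g X e0" "g S e1 = g X e1"
      using *[of e0] *[of e1] e sym[of S e0] sym[of S e1] sym[of e1 e0] by simp_all
    then have "g (S - X) Y = 0"
      using Y[unfolded V_def] linear_eq_0_on_span[OF lin, of "{e0, e1}" "S - X" Y] diff by auto
    then show ?thesis
      by (simp add: diff)
  qed
  note S_eq = this
  have unique: "T = S" if "T \<in> V" "\<And>Y. Y \<in> V \<Longrightarrow> g T Y = g X Y" for T
  proof -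
    have "T - S \<in> V"
      using that S unfolding V_def by (intro span_diff)
    then have "T - S = 0"
      by (rule lorentzian_plane_nondegenerate[OF lin sym V]) (simp add: diff that S_eq)
    then show ?thesis by simp
  qed
  have eq: "tangential_part g V X = S"
    unfolding tangential_part_def
  proof (rule the_equality)
    show "S \<in> V \<and> (\<forall>Y\<in>V. g (X - S) Y = 0)"
      using S S_eq by (simp add: diff)
    show "T = S" if "T \<in> V \<and> (\<forall>Y\<in>V. g (X - T) Y = 0)" for T
      using that by (intro unique) (auto simp: diff)
  qed
  show "tangential_part g V X \<in> V"
    unfolding eq by (rule S)
  show "Y \<in> V \<Longrightarrow> g (tangential_part g V X) Y = g X Y"
    unfolding eq by (rule S_eq)
  show "T \<in> V \<Longrightarrow> (\<And>Y. Y \<in> V \<Longrightarrow> g T Y = g X Y) \<Longrightarrow> tangential_part g V X = T"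
    unfolding eq by (rule unique[symmetric])
qed

lemma linear_plane_expand:
  fixes D :: "real \<times> real \<Rightarrow> 'e::real_vector"
  assumes "linear D"
  shows "D (x, y) = x *\<^sub>R D (1, 0) + y *\<^sub>R D (0, 1)"
proof -
  have "D (x *\<^sub>R (1, 0) + y *\<^sub>R (0, 1)) = x *\<^sub>R D (1, 0) + y *\<^sub>R D (0, 1)"
    by (simp only: linear_add[OF assms] linear_cmul[OF assms])
  then show ?thesis
    by (simp only: scaleR_Pair add_Pair real_scaleR_def mult_1_right mult_zero_right add_0 add_0_right)
qed

text \<open>
  Here \<open>D\<close> is the derivative of a parametrization whose first coordinate is the height, and \<open>X\<close> is
  the vertical field, so that \<open>g X\<close> is the differential of the first coordinate.  With \<open>T = D (x, y)\<close>
  one gets \<open>g T T = g X T = x\<close>, so a null \<open>T\<close> is a multiple of the second coordinate vector.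
\<close>

lemma lightlike_tangential_part_imp_null_coordinate:
  fixes D :: "real \<times> real \<Rightarrow> 'e::real_vector"
  assumes lin: "\<And>x. linear (g x)" and sym: "\<And>x y. g x y = g y x"
    and V: "lorentzian_plane g (range D)" and "linear D" and dual: "\<And>x y. g X (D (x, y)) = x"
    and light: "lightlike g (tangential_part g (range D) X)"
  shows "g (D (0, 1)) (D (0, 1)) = 0" "g (D (1, 0)) (D (0, 1)) \<noteq> 0"
proof -
  define T where "T = tangential_part g (range D) X"
  have T: "T \<in> range D" "\<And>w. g T (D w) = g X (D w)"
    using tangential_part_lorentzian(1,2)[OF lin sym V] by (auto simp: T_def)
  then obtain x y where xy: "T = D (x, y)"
    by (metis imageE surj_pair)
  have "g T T = 0"
    using light by (simp add: T_def lightlike_def)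
  then have "x = 0"
    using T(2)[of "(x, y)"] dual by (simp add: xy)
  then have Ty: "T = y *\<^sub>R D (0, 1)"
    using xy linear_plane_expand[OF \<open>linear D\<close>, of x y] by simp
  moreover have gT: "g T Z = y * g (D (0, 1)) Z" for Z
    using linear_cmul[OF lin, of Z y "D (0, 1)"] sym by (simp add: Ty)
  ultimately have "y \<noteq> 0"
    using light by (auto simp: T_def lightlike_def)
  then show "g (D (0, 1)) (D (0, 1)) = 0"
    using gT[of "D (0, 1)"] T(2)[of "(0, 1)"] dual[of 0 1] by simp
  show "g (D (1, 0)) (D (0, 1)) \<noteq> 0"
    using gT[of "D (1, 0)"] T(2)[of "(1, 0)"] dual[of 1 0] sym by auto
qed

text \<open>
  For the metric \<open>E (du dv + dv du)\<close> the gradient of \<open>u\<close> is \<open>(1 / E) \<partial>\<^sub>v\<close>.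
\<close>

lemma null_coordinates_imp_lightlike_tangential_part:
  fixes D :: "real \<times> real \<Rightarrow> 'e::real_vector"
  assumes lin: "\<And>x. linear (g x)" and sym: "\<And>x y. g x y = g y x"
    and V: "lorentzian_plane g (range D)" and dual: "\<And>x y. g X (D (x, y)) = x"
    and null: "\<And>x y x' y'. g (D (x, y)) (D (x', y')) = E * (x * y' + y * x')" and "E \<noteq> 0"
  shows "lightlike g (tangential_part g (range D) X)"
proof -
  let ?T = "D (0, 1 / E)"
  have "tangential_part g (range D) X = ?T"
    using \<open>E \<noteq> 0\<close> by (intro tangential_part_lorentzian(3)[OF lin sym V]) (auto simp: null dual)
  moreover have "?T \<noteq> 0"
    using null[of 0 "1 / E" 1 0] \<open>E \<noteq> 0\<close> linear_0[OF lin, of "D (1, 0)"] sym by auto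
  ultimately show ?thesis
    by (simp add: lightlike_def null)
qed

lemma lorentzian_plane_range:
  fixes D :: "real \<times> real \<Rightarrow> 'e::real_vector"
  assumes "linear D" "\<rho> > 0" "E \<noteq> 0"
    and metric: "\<And>x y x' y'. g (D (x, y)) (D (x', y')) = - 1 / \<rho>\<^sup>2 * (x * x') + E / \<rho>\<^sup>2 * (x * y' + y * x')"
  shows "lorentzian_plane g (range D)"
  unfolding lorentzian_plane_def
proof (intro exI conjI)
  \<comment> \<open>The time-like coordinate vector is normalized; the second vector of the basis is orthogonal to it.\<close>
  let ?e0 = "D (\<rho>, 0)" and ?e1 = "D (\<rho>, \<rho> / E)"
  have "D (x, y) = (x / \<rho> - y * E / \<rho>) *\<^sub>R ?e0 + (y * E / \<rho>) *\<^sub>R ?e1" for x y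
    using assms(2,3) linear_add[OF assms(1), symmetric] linear_cmul[OF assms(1), symmetric]
    by (simp add: field_simps)
  moreover have "x *\<^sub>R ?e0 + y *\<^sub>R ?e1 \<in> span {?e0, ?e1}" for x y
    by (intro span_add span_scale span_base) auto
  ultimately have "D (x, y) \<in> span {?e0, ?e1}" for x y
    by metis
  then have "range D \<subseteq> span {?e0, ?e1}"
    by auto
  moreover have "span {?e0, ?e1} \<subseteq> range D"
    by (rule span_minimal) (auto intro: linear_subspace_image assms(1) subspace_UNIV)
  ultimately show "range D = span {?e0, ?e1}" by blast
qed (use assms in \<open>simp_all add: metric power2_eq_square field_simps\<close>)

text \<open>
  The metric is nondegenerate, so no nonzero vector is mapped to a vector orthogonal to all others.
\<close>

lemma inj_if_null_height_metric:
  fixes D :: "real \<times> real \<Rightarrow> 'e::real_vector"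
  assumes "linear D" "\<rho> > 0" "E \<noteq> 0" "\<And>z. g 0 z = 0"
    and metric: "\<And>x y x' y'. g (D (x, y)) (D (x', y')) = - 1 / \<rho>\<^sup>2 * (x * x') + E / \<rho>\<^sup>2 * (x * y' + y * x')"
  shows "inj D"
  unfolding linear_injective_0[OF assms(1)]
proof (intro allI impI)
  fix X assume "D X = 0"
  moreover obtain x y where X: "X = (x, y)" by fastforce
  ultimately have "g (D (x, y)) (D (0, 1)) = 0" "g (D (x, y)) (D (1, 0)) = 0"
    using assms(4) by simp_all
  then show "X = 0"
    unfolding metric X using assms(2,3) by (simp add: zero_prod_def)
qed

section \<open>Surfaces with light-like tangential part of the vertical field\<close>

lemma bounded_bilinear_space_form_metric: "bounded_bilinear (space_form_metric c)"
proof -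
  have "bilinear (space_form_metric c)"
    unfolding bilinear_def by (auto intro!: linearI simp: space_form_metric_def algebra_simps)
  then show ?thesis by (simp add: bilinear_conv_bounded_bilinear)
qed

lemma space_form_metric_sym: "space_form_metric c x y = space_form_metric c y x"
  by (simp add: space_form_metric_def)

lemma warped_metric_sym: "warped_metric c f p x y = warped_metric c f p y x"
  by (simp add: warped_metric_def space_form_metric_sym mult.commute)

lemma linear_warped_metric: "linear (warped_metric c f p x)"
  by (rule linearI) (simp_all add: warped_metric_def space_form_metric_def algebra_simps)

lemma warped_metric_d_dz: "warped_metric c f p d_dz Y = snd Y"
  by (simp add: warped_metric_def d_dz_def space_form_metric_def)

lemma height_parametrization_derivative:
  assumes "local_param M F W \<kappa>" "\<And>x. x \<in> W \<Longrightarrow> F (\<kappa> x) = (P x, fst x)" "w \<in> W"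
    "(P has_derivative P') (at w)"
  shows "frechet_derivative (F \<circ> \<kappa>) (at w) = (\<lambda>v. (P' v, fst v))"
proof -
  have "((\<lambda>x. (P x, fst x)) has_derivative (\<lambda>v. (P' v, fst v))) (at w)"
    by (auto intro!: derivative_eq_intros assms(4))
  then have "(F \<circ> \<kappa> has_derivative (\<lambda>v. (P' v, fst v))) (at w)"
    by (rule has_derivative_transform_within_open[OF _ local_param_open[OF assms(1)] assms(3)])
      (simp add: assms(2))
  then show ?thesis
    using frechet_derivative_at by metis
qed

lemma lightlike_if_null_coordinates:
  fixes F :: "'m::topological_space \<Rightarrow> (real ^ 4) \<times> real" and W :: "(real \<times> real) set"
  assumes surf: "timelike_surface (warped_metric c f) N M F"
    and p: "local_param M F W \<kappa>" and F: "\<And>u v. (u, v) \<in> W \<Longrightarrow> F (\<kappa> (u, v)) = (\<phi> (u, v), u)"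
    and \<phi>: "smooth_on W \<phi>" and w: "(u, v) \<in> W" and "f u > 0" "E \<noteq> (0 :: real)"
    and metric: "\<And>X1 X2 Y1 Y2. induced_metric (\<lambda>_. space_form_metric c) \<phi> (u, v) (X1, X2) (Y1, Y2) =
             - 1 / (f u)\<^sup>2 * (X1 * Y1) + E / (f u)\<^sup>2 * (X1 * Y2 + X2 * Y1)"
  shows "lightlike (warped_metric c f (F (\<kappa> (u, v)))) (T_part c f M F (\<kappa> (u, v)))"
proof -
  define D where "D = frechet_derivative (F \<circ> \<kappa>) (at (u, v))"
  have D: "D = (\<lambda>X. (frechet_derivative \<phi> (at (u, v)) X, fst X))"
    unfolding D_def
    by (rule height_parametrization_derivative[OF p _ w smooth_on_has_derivative[OF \<phi> w]]) (use F in auto)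
  have "lorentzian_plane (warped_metric c f (F (\<kappa> (u, v)))) (range D)"
    using surf local_param_mem[OF p w] unfolding timelike_surface_def D_def
    by (metis tangent_plane_eq_range[OF p w])
  then have "lightlike (warped_metric c f (F (\<kappa> (u, v)))) (tangential_part (warped_metric c f (F (\<kappa> (u, v)))) (range D) d_dz)"
  proof (rule null_coordinates_imp_lightlike_tangential_part[OF linear_warped_metric warped_metric_sym _ _ _ \<open>E \<noteq> 0\<close>])
    show "warped_metric c f (F (\<kappa> (u, v))) (D (x, y)) (D (x', y')) = E * (x * y' + y * x')" for x y x' y'
    proof -
      have "warped_metric c f (F (\<kappa> (u, v))) (D (x, y)) (D (x', y')) =
          (f u)\<^sup>2 * (- 1 / (f u)\<^sup>2 * (x * x') + E / (f u)\<^sup>2 * (x * y' + y * x')) + x * x'"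
        unfolding metric[symmetric] by (simp add: warped_metric_def D F[OF w] induced_metric_def)
      moreover have "k * (- 1 / k * X + E / k * Y) + X = E * Y" if "k \<noteq> 0" for k X Y :: real
        using that by (simp add: field_simps)
      ultimately show ?thesis
        using \<open>f u > 0\<close> by simp
    qed
  qed (simp add: warped_metric_d_dz D)
  then show ?thesis
    by (simp add: T_part_def D_def tangent_plane_eq_range[OF p w])
qed

text \<open>
  The construction of the coordinates: first \<open>(u, s)\<close> with \<open>u\<close> the height and \<open>\<partial>\<^sub>s\<close> null, then
  \<open>s = \<sigma>(u, v)\<close>, where \<open>\<sigma>\<close> is the flow of the second null direction \<open>\<partial>\<^sub>u + a \<partial>\<^sub>s\<close>, and finally a
  restriction to a ball on which the projection to the space form is an embedding.
\<close>

lemma null_coordinates_if_lightlike: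
  fixes F :: "'m::topological_space \<Rightarrow> (real ^ 4) \<times> real"
  assumes "open I" "smooth_on I f" "\<And>z. z \<in> I \<Longrightarrow> f z > 0"
    and surf: "timelike_surface (warped_metric c f) (space_form c \<times> I) M F"
    and light: "\<And>p. p \<in> M \<Longrightarrow> lightlike (warped_metric c f (F p)) (T_part c f M F p)" and "p \<in> M"
  obtains W \<kappa> and P :: "real \<times> real \<Rightarrow> real ^ 4" and E :: "real \<times> real \<Rightarrow> real"
  where "local_param M F W \<kappa>" "p \<in> \<kappa> ` W"
    "\<And>u v. (u, v) \<in> W \<Longrightarrow> F (\<kappa> (u, v)) = (P (u, v), u)"
    "\<exists>P'. homeomorphism W (P ` W) P P'" "smooth_on W P" "smooth_on W E" "\<And>w. w \<in> W \<Longrightarrow> E w \<noteq> 0"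
    "\<And>u v X1 X2 Y1 Y2. (u, v) \<in> W \<Longrightarrow>
      induced_metric (\<lambda>_. space_form_metric c) P (u, v) (X1, X2) (Y1, Y2) =
        - 1 / (f u)\<^sup>2 * (X1 * Y1) + E (u, v) / (f u)\<^sup>2 * (X1 * Y2 + X2 * Y1)"
proof -
  let ?g = "space_form_metric c"
  interpret g: bounded_bilinear ?g
    by (rule bounded_bilinear_space_form_metric)
  have immersed: "immersed_surface (space_form c \<times> I) M F"
    using surf by (simp add: timelike_surface_def)
  then obtain W0 \<kappa>0 w0 where p0: "local_param M F (W0 :: (real \<times> real) set) \<kappa>0" and w0: "w0 \<in> W0" "p = \<kappa>0 w0"
    using \<open>p \<in> M\<close> unfolding immersed_surface_def by blast
  have height: "snd (F q) \<in> I" if "q \<in> M" for q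
    using immersed that unfolding immersed_surface_def by (metis image_subset_iff mem_Times_iff)
  have lorentz: "lorentzian_plane (warped_metric c f (F (\<kappa> w))) (range (frechet_derivative (F \<circ> \<kappa>) (at w)))"
    if "local_param M F W \<kappa>" "w \<in> W" for W \<kappa> and w :: "real \<times> real"
    using surf local_param_mem[OF that] tangent_plane_eq_range[OF that] unfolding timelike_surface_def by metis

  define h where "h w = snd (F (\<kappa>0 w))" for w
  have smooth_h: "smooth_on W0 h"
    using local_param_smooth[OF p0] times_differentiable_on_snd[OF local_param_open[OF p0]]
    unfolding smooth_on_def h_def comp_def by blast
  have "\<exists>v0. frechet_derivative h (at w0) v0 \<noteq> 0"
  proof (rule ccontr)
    \<comment> \<open>A critical point of the height would make the vertical field normal to the surface, hence its tangential part zero.\<close>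
    assume contr: "\<nexists>v0. frechet_derivative h (at w0) v0 \<noteq> 0"
    let ?D = "frechet_derivative (F \<circ> \<kappa>0) (at w0)"
    have "(h has_derivative (\<lambda>v. snd (?D v))) (at w0)"
      using bounded_linear.has_derivative[OF bounded_linear_snd local_param_derivative[OF p0 w0(1)]]
      by (simp add: h_def[abs_def])
    then have "snd (?D v) = 0" for v
      using contr frechet_derivative_at by metis
    then have "tangential_part (warped_metric c f (F p)) (range ?D) d_dz = 0"
      unfolding w0(2)
      by (intro tangential_part_lorentzian(3)[OF linear_warped_metric warped_metric_sym lorentz[OF p0 w0(1)]])
        (auto simp: warped_metric_d_dz linear_0[OF linear_warped_metric] warped_metric_sym[of c f _ 0]
          intro: range_eqI[of _ _ 0] simp: linear_0[OF bounded_linear.linear[OF has_derivative_bounded_linear[OF local_param_derivative[OF p0 w0(1)]]]])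
    then show False
      using light[OF \<open>p \<in> M\<close>] tangent_plane_eq_range[OF p0 w0(1)] by (simp add: T_part_def w0(2) lightlike_def)
  qed
  then obtain v0 where v0: "frechet_derivative h (at w0) v0 \<noteq> 0" ..
  obtain V and H :: "real \<times> real \<Rightarrow> real \<times> real" where "open V" and w0_H: "w0 \<in> H ` V" and H: "inj_on H V" "smooth_on V H" "H ` V \<subseteq> W0"
    and level: "\<And>y. y \<in> V \<Longrightarrow> h (H y) = fst y"
    and inj_H: "\<And>y. y \<in> V \<Longrightarrow> inj (frechet_derivative H (at y))"
    by (rule level_set_coordinates[OF local_param_open[OF p0] smooth_h w0(1) v0], rule that)
  obtain y0 where "y0 \<in> V" and H_y0: "H y0 = w0"
    using w0_H by blast
  note V = \<open>open V\<close> \<open>y0 \<in> V\<close>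
  define \<kappa>1 where "\<kappa>1 = \<kappa>0 \<circ> H"
  have p1: "local_param M F V \<kappa>1"
    unfolding \<kappa>1_def by (rule local_param_compose[OF p0 V(1) H(3,1,2) inj_H])
  define P1 where "P1 y = fst (F (\<kappa>1 y))" for y
  have F1: "F (\<kappa>1 y) = (P1 y, fst y)" if "y \<in> V" for y
    using level[OF that] by (simp add: P1_def \<kappa>1_def h_def prod_eq_iff)
  have smooth_P1: "smooth_on V P1"
    using local_param_smooth[OF p1] times_differentiable_on_fst[OF V(1)]
    unfolding smooth_on_def P1_def comp_def by blast
  have in_I: "fst y \<in> I" if "y \<in> V" for y
    using height[OF local_param_mem[OF p1 that]] F1[OF that] by simp
  define \<alpha> \<beta> where "\<alpha> y = ?g (frechet_derivative P1 (at y) (1, 0)) (frechet_derivative P1 (at y) (1, 0))"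
    and "\<beta> y = ?g (frechet_derivative P1 (at y) (1, 0)) (frechet_derivative P1 (at y) (0, 1))" for y
  have smooth_\<alpha>\<beta>: "smooth_on V \<alpha>" "smooth_on V \<beta>"
    using smooth_on_frechet_derivative[OF smooth_P1]
    unfolding smooth_on_def \<alpha>_def \<beta>_def
    by (auto intro!: times_differentiable_on_bounded_bilinear[OF g.bounded_bilinear_axioms V(1)])
  have linear_P1: "linear (frechet_derivative P1 (at y))" if "y \<in> V" for y
    by (rule bounded_linear.linear[OF has_derivative_bounded_linear[OF smooth_on_has_derivative[OF smooth_P1 that]]])
  have null: "?g (frechet_derivative P1 (at y) (0, 1)) (frechet_derivative P1 (at y) (0, 1)) = 0" "\<beta> y \<noteq> 0"
    if y: "y \<in> V" for y
  proof -
    define D where "D = frechet_derivative (F \<circ> \<kappa>1) (at y)"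
    have D: "D = (\<lambda>X. (frechet_derivative P1 (at y) X, fst X))"
      unfolding D_def
      by (rule height_parametrization_derivative[OF p1 F1 y smooth_on_has_derivative[OF smooth_P1 y]])
    have "linear D"
      unfolding D_def
      by (rule bounded_linear.linear[OF has_derivative_bounded_linear[OF local_param_derivative[OF p1 y]]])
    have "lightlike (warped_metric c f (F (\<kappa>1 y))) (tangential_part (warped_metric c f (F (\<kappa>1 y))) (range D) d_dz)"
      using light[OF local_param_mem[OF p1 y]] tangent_plane_eq_range[OF p1 y] by (simp add: T_part_def D_def)
    note lightlike_tangential_part_imp_null_coordinate[OF linear_warped_metric warped_metric_sym
        lorentz[OF p1 y, folded D_def] \<open>linear D\<close> _ this]
    then have "warped_metric c f (F (\<kappa>1 y)) (D (0, 1)) (D (0, 1)) = 0"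
      "warped_metric c f (F (\<kappa>1 y)) (D (1, 0)) (D (0, 1)) \<noteq> 0"
      by (simp_all add: warped_metric_d_dz D)
    then show "?g (frechet_derivative P1 (at y) (0, 1)) (frechet_derivative P1 (at y) (0, 1)) = 0" "\<beta> y \<noteq> 0"
      using assms(3)[OF in_I[OF y]] by (auto simp: warped_metric_def D F1[OF y] \<beta>_def)
  qed
  have smooth_f: "smooth_on V (\<lambda>y. f (fst y))"
    by (rule smooth_on_compose[OF V(1) assms(1) _ _ assms(2)])
      (auto simp: smooth_on_def dest: in_I intro!: times_differentiable_on_intros V(1))
  have f_pos: "f (fst y) > 0" if "y \<in> V" for y
    using assms(3) in_I[OF that] by blast

  \<comment> \<open>With the metric coefficients \<open>f\<^sup>2 \<alpha> + 1\<close>, \<open>f\<^sup>2 \<beta>\<close> and \<open>0\<close>, the vector \<open>\<partial>\<^sub>u + a \<partial>\<^sub>s\<close> is null for this \<open>a\<close>.\<close>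
  define a where "a y = - (f (fst y) * f (fst y) * \<alpha> y + 1) / (2 * (f (fst y) * f (fst y) * \<beta> y))" for y
  have "smooth_on V a"
    using smooth_\<alpha>\<beta> smooth_f null(2) f_pos unfolding smooth_on_def a_def
    by (auto intro!: times_differentiable_on_intros V(1) simp: less_le)
  obtain u0 s0 where y0: "y0 = (u0, s0)" by fastforce
  obtain d \<sigma> e Q where "d > 0" and Q: "Q = {u0 - d<..<u0 + d} \<times> {s0 - d<..<s0 + d}"
    and smooth_flow: "smooth_on Q \<sigma>" "smooth_on Q e" and e_pos: "\<And>x. x \<in> Q \<Longrightarrow> e x > 0"
    and in_V: "\<And>x. x \<in> Q \<Longrightarrow> (fst x, \<sigma> x) \<in> V"
    and d\<sigma>: "\<And>x. x \<in> Q \<Longrightarrow> (\<sigma> has_derivative (\<lambda>w. a (fst x, \<sigma> x) * fst w + e x * snd w)) (at x)"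
    and start: "\<sigma> (u0, s0) = s0"
    and inj_\<sigma>: "\<And>u v v'. (u, v) \<in> Q \<Longrightarrow> (u, v') \<in> Q \<Longrightarrow> \<sigma> (u, v) = \<sigma> (u, v') \<Longrightarrow> v = v'"
    by (rule smooth_scalar_flow[OF V(1) \<open>smooth_on V a\<close> V(2)[unfolded y0]], rule that)
  have openQ: "open Q" and y0Q: "y0 \<in> Q"
    using \<open>d > 0\<close> by (auto simp: Q y0 intro: open_Times)
  define S where "S x = (fst x, \<sigma> x)" for x
  have S: "S ` Q \<subseteq> V" "S y0 = y0"
    using in_V start by (auto simp: S_def y0)
  have inj_S: "inj_on S Q"
    using inj_\<sigma> by (auto simp: inj_on_def S_def)
  have smooth_S: "smooth_on Q S"
    using smooth_flow openQ by (auto simp: smooth_on_def S_def[abs_def] intro!: times_differentiable_on_intros)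
  have dS: "(S has_derivative (\<lambda>w. (fst w, a (S x) * fst w + e x * snd w))) (at x)" if "x \<in> Q" for x
    unfolding S_def by (auto intro!: derivative_eq_intros d\<sigma>[OF that])
  have inj_dS: "inj (frechet_derivative S (at x))" if "x \<in> Q" for x
    unfolding frechet_derivative_at[OF dS[OF that], symmetric]
    using e_pos[OF that] by (auto simp: inj_on_def)
  define P2 where "P2 x = P1 (S x)" for x
  have smooth_P2: "smooth_on Q P2"
    unfolding P2_def by (rule smooth_on_compose[OF openQ V(1) smooth_S S(1) smooth_P1])
  \<comment> \<open>The product of the coordinate fields \<open>\<partial>\<^sub>u + a \<partial>\<^sub>s\<close> and \<open>e \<partial>\<^sub>s\<close>.\<close>
  define E where "E x = f (fst x) * f (fst x) * \<beta> (S x) * e x" for x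
  have SV: "S x \<in> V" if "x \<in> Q" for x
    using S(1) that by blast
  have smooth_E: "smooth_on Q E"
  proof -
    have "smooth_on Q (\<lambda>x. \<beta> (S x))" "smooth_on Q (\<lambda>x. f (fst (S x)))"
      using smooth_on_compose[OF openQ V(1) smooth_S S(1)] smooth_\<alpha>\<beta>(2) smooth_f by blast+
    then show ?thesis
      using smooth_flow(2) openQ by (auto simp: smooth_on_def E_def[abs_def] S_def[abs_def] intro!: times_differentiable_on_intros)
  qed
  have E_nz: "E x \<noteq> 0" if "x \<in> Q" for x
    using f_pos[OF SV[OF that]] null(2)[OF SV[OF that]] e_pos[OF that] by (simp add: E_def S_def)
  have metric: "induced_metric (\<lambda>_. ?g) P2 x X Y =
      - 1 / (f (fst x))\<^sup>2 * (fst X * fst Y) + E x / (f (fst x))\<^sup>2 * (fst X * snd Y + snd X * fst Y)"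
    if x: "x \<in> Q" for x X Y
  proof -
    let ?u = "frechet_derivative P1 (at (S x)) (1, 0)" and ?s = "frechet_derivative P1 (at (S x)) (0, 1)"
    have "(P2 has_derivative (\<lambda>w. frechet_derivative P1 (at (S x)) (fst w, a (S x) * fst w + e x * snd w))) (at x)"
      unfolding P2_def
      by (rule has_derivative_compose[OF dS[OF x] smooth_on_has_derivative[OF smooth_P1 SV[OF x]]])
    from frechet_derivative_at[OF this, symmetric]
    have dP2: "frechet_derivative P2 (at x) w = fst w *\<^sub>R ?u + (a (S x) * fst w + e x * snd w) *\<^sub>R ?s" for w
      using linear_plane_expand[OF linear_P1[OF SV[OF x]], of "fst w" "a (S x) * fst w + e x * snd w"] by metis
    have ss: "?g ?s ?s = 0" and su: "?g ?s ?u = \<beta> (S x)" and us: "?g ?u ?s = \<beta> (S x)" and uu: "?g ?u ?u = \<alpha> (S x)"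
      using null(1)[OF SV[OF x]] space_form_metric_sym[of c ?s ?u] by (simp_all add: \<alpha>_def \<beta>_def)
    have "induced_metric (\<lambda>_. ?g) P2 x X Y =
        fst X * fst Y * (\<alpha> (S x) + 2 * a (S x) * \<beta> (S x)) + \<beta> (S x) * e x * (fst X * snd Y + snd X * fst Y)"
      by (simp add: induced_metric_def dP2 g.add_left g.add_right g.scaleR_left g.scaleR_right ss su us uu)
        (simp add: algebra_simps)
    also have "\<alpha> (S x) + 2 * a (S x) * \<beta> (S x) = - 1 / (f (fst x))\<^sup>2"
      using f_pos[OF SV[OF x]] null(2)[OF SV[OF x]]
      by (simp add: a_def S_def power2_eq_square divide_simps)
    also have "\<beta> (S x) * e x = E x / (f (fst x))\<^sup>2"
      using f_pos[OF SV[OF x]] by (simp add: E_def S_def power2_eq_square)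
    finally show ?thesis by (simp add: mult.commute)
  qed
  have "inj (frechet_derivative P2 (at y0))"
  proof (rule inj_if_null_height_metric[where g = ?g])
    show "linear (frechet_derivative P2 (at y0))"
      by (rule bounded_linear.linear[OF has_derivative_bounded_linear[OF smooth_on_has_derivative[OF smooth_P2 y0Q]]])
    show "?g (frechet_derivative P2 (at y0) (x, y)) (frechet_derivative P2 (at y0) (x', y')) =
        - 1 / (f (fst y0))\<^sup>2 * (x * x') + E y0 / (f (fst y0))\<^sup>2 * (x * y' + y * x')" for x y x' y'
      using metric[OF y0Q, of "(x, y)" "(x', y')"] by (simp add: induced_metric_def)
  qed (use f_pos V(2) E_nz y0Q g.zero_left in auto)
  from immersion_locally_homeomorphism[OF openQ smooth_P2 y0Q this]
  obtain r P' where r: "r > 0" "ball y0 r \<subseteq> Q" and hom: "homeomorphism (ball y0 r) (P2 ` ball y0 r) P2 P'"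
    by metis
  let ?W = "ball y0 r"
  show thesis
  proof (rule that[of ?W "\<kappa>1 \<circ> S" P2 E])
    show "local_param M F ?W (\<kappa>1 \<circ> S)"
      by (rule local_param_compose[OF p1]) (use r S inj_S smooth_S inj_dS in
          \<open>auto intro: inj_on_subset smooth_on_subset\<close>)
    show "p \<in> (\<kappa>1 \<circ> S) ` ?W"
      using r(1) S(2) H_y0 w0(2) by (auto simp: \<kappa>1_def intro!: image_eqI[of _ _ y0])
    show "F ((\<kappa>1 \<circ> S) (u, v)) = (P2 (u, v), u)" if "(u, v) \<in> ?W" for u v
      using F1[OF SV, of "(u, v)"] r(2) that by (auto simp: P2_def S_def)
    show "\<exists>P'. homeomorphism ?W (P2 ` ?W) P2 P'"
      using hom by blast
    show "smooth_on ?W P2" "smooth_on ?W E"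
      using smooth_P2 smooth_E r(2) smooth_on_subset by blast+
    show "induced_metric (\<lambda>_. ?g) P2 (u, v) (X1, X2) (Y1, Y2) =
        - 1 / (f u)\<^sup>2 * (X1 * Y1) + E (u, v) / (f u)\<^sup>2 * (X1 * Y2 + X2 * Y1)"
      if "(u, v) \<in> ?W" for u v X1 X2 Y1 Y2
      using metric[of "(u, v)" "(X1, X2)" "(Y1, Y2)"] r(2) that by auto
  qed (use E_nz r(2) in auto)
qed

theorem theorem3p11:
  fixes c :: real and f :: "real \<Rightarrow> real" and I :: "real set"
    and M :: "'m::{t2_space, second_countable_topology} set"
    and F :: "'m \<Rightarrow> (real ^ 4) \<times> real"
  assumes "c \<in> {-1, 0, 1}"
    and "open I" and "is_interval I" and "I \<noteq> {}"
    and "smooth_on I f" and "\<forall>z\<in>I. f z > 0"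
    and "timelike_surface (warped_metric c f) (space_form c \<times> I) M F"
    and "\<forall>p\<in>M. T_part c f M F p \<noteq> 0"
    and "\<forall>p\<in>M. eta_part c f M F p \<noteq> 0"
    and "\<not> (\<exists>U S. openin (top_of_set M) U \<and> U \<noteq> {} \<and>
               totally_geodesic_hypersurface c f I S \<and> F ` U \<subseteq> S)"
  shows "(\<forall>p\<in>M. lightlike (warped_metric c f (F p)) (T_part c f M F p)) \<longleftrightarrow>
    (\<forall>p\<in>M. \<exists>(W :: (real \<times> real) set) \<kappa> (\<phi> :: real \<times> real \<Rightarrow> real ^ 4) Mhat
          (E :: real \<times> real \<Rightarrow> real).
        local_param M F W \<kappa> \<and> p \<in> \<kappa> ` W \<and>
        (\<forall>u v. (u, v) \<in> W \<longrightarrow> F (\<kappa> (u, v)) = (\<phi> (u, v), u)) \<and>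
        timelike_surface (\<lambda>_. space_form_metric c) (space_form c) Mhat (\<lambda>x. x) \<and>
        local_param Mhat (\<lambda>x. x) W \<phi> \<and> \<phi> ` W = Mhat \<and>
        smooth_on W E \<and> (\<forall>w\<in>W. E w \<noteq> 0) \<and>
        (\<forall>u v X\<^sub>1 X\<^sub>2 Y\<^sub>1 Y\<^sub>2. (u, v) \<in> W \<longrightarrow>
           induced_metric (\<lambda>_. space_form_metric c) \<phi> (u, v) (X\<^sub>1, X\<^sub>2) (Y\<^sub>1, Y\<^sub>2) =
             - 1 / (f u)\<^sup>2 * (X\<^sub>1 * Y\<^sub>1) + E (u, v) / (f u)\<^sup>2 * (X\<^sub>1 * Y\<^sub>2 + X\<^sub>2 * Y\<^sub>1)))"
proof (intro iffI ballI, goal_cases)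
  case (1 p)
  obtain W :: "(real \<times> real) set" and \<kappa> \<phi> and E where
    param: "local_param M F W \<kappa>" "p \<in> \<kappa> ` W" "\<And>u v. (u, v) \<in> W \<Longrightarrow> F (\<kappa> (u, v)) = (\<phi> (u, v), u)"
    and \<phi>: "\<exists>\<phi>'. homeomorphism W (\<phi> ` W) \<phi> \<phi>'" "smooth_on W \<phi>"
    and E: "smooth_on W E" "\<And>w. w \<in> W \<Longrightarrow> E w \<noteq> 0"
    and metric: "\<And>u v X1 X2 Y1 Y2. (u, v) \<in> W \<Longrightarrow>
      induced_metric (\<lambda>_. space_form_metric c) \<phi> (u, v) (X1, X2) (Y1, Y2) =
        - 1 / (f u)\<^sup>2 * (X1 * Y1) + E (u, v) / (f u)\<^sup>2 * (X1 * Y2 + X2 * Y1)"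
    by (rule null_coordinates_if_lightlike[OF assms(2,5) _ assms(7) _ 1(2)])
      (use 1(1) assms(6) in blast)+
  have F_in: "\<phi> (u, v) \<in> space_form c \<and> u \<in> I" if "(u, v) \<in> W" for u v
    using assms(7) local_param_mem[OF param(1) that] param(3)[OF that]
    unfolding timelike_surface_def immersed_surface_def by auto
  have linear: "linear (frechet_derivative \<phi> (at w))" if "w \<in> W" for w
    by (rule bounded_linear.linear[OF has_derivative_bounded_linear[OF smooth_on_has_derivative[OF \<phi>(2) that]]])
  have inj: "inj (frechet_derivative \<phi> (at w))" if w: "w \<in> W" for w
  proof (rule inj_if_null_height_metric[OF linear[OF w], of "f (fst w)" "E w" "space_form_metric c"])
    show "space_form_metric c (frechet_derivative \<phi> (at w) (x, y)) (frechet_derivative \<phi> (at w) (x', y')) =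
        - 1 / (f (fst w))\<^sup>2 * (x * x') + E w / (f (fst w))\<^sup>2 * (x * y' + y * x')" for x y x' y'
      using metric[of "fst w" "snd w" x y x' y'] w by (simp add: induced_metric_def)
  qed (use E(2)[OF w] F_in[of "fst w" "snd w"] w assms(6) in
      \<open>auto simp: bounded_bilinear.zero_left[OF bounded_bilinear_space_form_metric]\<close>)
  have local: "local_param (\<phi> ` W) (\<lambda>x. x) W \<phi>"
    using \<phi> inj local_param_open[OF param(1)] by (simp add: local_param_def comp_def)
  have "timelike_surface (\<lambda>_. space_form_metric c) (space_form c) (\<phi> ` W) (\<lambda>x. x)"
    unfolding timelike_surface_def immersed_surface_def
  proof (intro conjI ballI)
    show "(\<lambda>x. x) ` \<phi> ` W \<subseteq> space_form c"
      using F_in by auto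
    show "\<exists>(W' :: (real \<times> real) set) \<kappa>. local_param (\<phi> ` W) (\<lambda>x. x) W' \<kappa> \<and> q \<in> \<kappa> ` W'" if "q \<in> \<phi> ` W" for q
      using local that by blast
    fix q assume "q \<in> \<phi> ` W"
    then obtain u v where uv: "(u, v) \<in> W" "q = \<phi> (u, v)" by auto
    have "lorentzian_plane (space_form_metric c) (range (frechet_derivative \<phi> (at (u, v))))"
      by (rule lorentzian_plane_range[OF linear[OF uv(1)], of "f u" "E (u, v)"])
        (use metric[OF uv(1)] E(2) F_in uv(1) assms(6) in \<open>auto simp: induced_metric_def\<close>)
    then show "lorentzian_plane (space_form_metric c) (tangent_plane (\<phi> ` W) (\<lambda>x. x) q)"
      using tangent_plane_eq_range[OF local uv(1)] by (simp add: uv(2) comp_def)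
  qed
  with param local E metric show ?case
    by (intro exI[of _ W] exI[of _ \<kappa>] exI[of _ \<phi>] exI[of _ "\<phi> ` W"] exI[of _ E]) simp
next
  case (2 p)
  from 2(1)[rule_format, OF 2(2)] obtain W :: "(real \<times> real) set" and \<kappa>
    and \<phi> :: "real \<times> real \<Rightarrow> real ^ 4" and Mhat and E :: "real \<times> real \<Rightarrow> real"
    where param: "local_param M F W \<kappa>" and p: "p \<in> \<kappa> ` W"
      and F: "\<forall>u v. (u, v) \<in> W \<longrightarrow> F (\<kappa> (u, v)) = (\<phi> (u, v), u)"
      and \<phi>: "local_param Mhat (\<lambda>x. x) W \<phi>" and E: "\<forall>w\<in>W. E w \<noteq> 0"
      and metric: "\<forall>u v X1 X2 Y1 Y2. (u, v) \<in> W \<longrightarrow>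
         induced_metric (\<lambda>_. space_form_metric c) \<phi> (u, v) (X1, X2) (Y1, Y2) =
           - 1 / (f u)\<^sup>2 * (X1 * Y1) + E (u, v) / (f u)\<^sup>2 * (X1 * Y2 + X2 * Y1)"
    by (elim exE conjE) (rule that)
  from p obtain u v where uv: "(u, v) \<in> W" "p = \<kappa> (u, v)"
    by auto
  have "u \<in> I"
    using assms(7) local_param_mem[OF param uv(1)] F uv(1)
    unfolding timelike_surface_def immersed_surface_def by fastforce
  then show ?case
    unfolding uv(2)
    by (intro lightlike_if_null_coordinates[OF assms(7) param _ _ uv(1), of \<phi> "E (u, v)"])
      (use F metric E uv(1) assms(6) local_param_smooth[OF \<phi>] in \<open>auto simp: comp_def\<close>)
qed

end
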